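(* Let $d\ge 1$ and let $\mathbf X=(X_t)_{t\ge 0}$ be an isotropic unimodal Lévy process in $\mathbb R^d$ with Lévy–Khintchine exponent $\psi$ and transition density $p(t,\cdot)$ on $\mathbb R^d\setminus\{0\}$. If $\psi\in\mathcal R^\infty_\alpha$ for some $\alpha\in(0,2)$, then $$\lim_{\substack{x\to0\\ t\psi(|x|^{-1})\to 0}}\frac{p(t,x)}{|x|^{-d}\,t\,\psi(|x|^{-1})}=\mathcal A_{d,\alpha},$$ where $$\mathcal A_{d,\alpha}=\alpha\,2^{\alpha-1}\pi^{-d/2-1}\sin\Big(\frac{\alpha\pi}{2}\Big)\Gamma\Big(\frac{\alpha}{2}\Big)\Gamma\Big(\frac{d+\alpha}{2}\Big).$$
   Context: An isotropic Lévy process in $\mathbb R^d$ is a Lévy process $\mathbf X=(X_t)_{t\ge0}$ with $X_0=0$ a.s. such that each $X_t$ has a rotationally invariant distribution $p(t,dx)$. Its Lévy–Khintchine exponent $\psi$ is defined by $\int_{\mathbb R^d}e^{i\langle\xi,x\rangle}p(t,dx)=e^{-t\psi(\xi)}$, with $\psi(\xi)=\int_{\mathbb R^d}(1-\cos\langle\xi,x\rangle)\,\nu(dx)+\eta|\xi|^2$, where $\eta\ge0$ and $\nu$ is a rotationally invariant Lévy measure. The function $\psi$ is radial and one writes $\psi(r)=\psi(\xi)$ for $r=|\xi|$. A Borel measure is isotropic unimodal if it is absolutely continuous on $\mathbb R^d\setminus\{0\}$ with a radial, radially non-increasing density. $\mathbf X$ is isotropic unimodal if $p(t,dx)$ is isotropic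 unimodal for every $t>0$; then $p(t,x)$ denotes this radial, radially non-increasing density on $\mathbb R^d\setminus\{0\}$. Regular variation: a function $f$, positive on some $[x_0,+\infty)$ with $x_0>0$, is in $\mathcal R^\infty_\alpha$ (regularly varying of index $\alpha$ at infinity) if $f(\lambda x)/f(x)\to\lambda^\alpha$ as $x\to+\infty$ for each $\lambda>0$. The condition $\psi\in\mathcal R^\infty_\alpha$ refers to $r\mapsto\psi(r)$. The joint limit means: for every $\varepsilon>0$ there is $\delta>0$ such that the quotient is within $\varepsilon$ of the limit for all $t>0$ and all $x$ with $0<|x|\le\delta$ and $t\psi(|x|^{-1})\le\delta$. *)

theory Defs
  imports "HOL-Probability.Probability"
begin

text \<open>
  The paths are only required to be stochastically continuous. Every such process has a
  cadlag modification with the same one-dimensional distributions.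
\<close>

locale levy_process = prob_space M
  for M :: "'w measure" and X :: "real \<Rightarrow> 'w \<Rightarrow> 'a::euclidean_space" +
  assumes random_variable: "\<And>t. 0 \<le> t \<Longrightarrow> random_variable borel (X t)"
    and starts_at_zero: "AE \<omega> in M. X 0 \<omega> = 0"
    and independent_increments:
      "\<And>(\<tau> :: nat \<Rightarrow> real) n. 0 \<le> \<tau> 0 \<Longrightarrow> mono \<tau> \<Longrightarrow>
         indep_vars (\<lambda>_. borel) (\<lambda>i \<omega>. X (\<tau> (Suc i)) \<omega> - X (\<tau> i) \<omega>) {..<n}"
    and stationary_increments:
      "\<And>s t. 0 \<le> s \<Longrightarrow> s \<le> t \<Longrightarrow>
         distr M borel (\<lambda>\<omega>. X t \<omega> - X s \<omega>) = distr M borel (X (t - s))"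
    and stochastically_continuous:
      "\<And>s \<epsilon>. 0 \<le> s \<Longrightarrow> 0 < \<epsilon> \<Longrightarrow>
         ((\<lambda>t. prob {\<omega> \<in> space M. \<epsilon> < dist (X t \<omega>) (X s \<omega>)}) \<longlongrightarrow> 0) (at s within {0..})"

text \<open>
  Invariance under the full orthogonal group. In dimension one this is symmetry; in higher
  dimensions it is equivalent to invariance under proper rotations.
\<close>

definition rotation_invariant :: "'a::euclidean_space measure \<Rightarrow> bool" where
  "rotation_invariant \<mu> \<longleftrightarrow> (\<forall>U. orthogonal_transformation U \<longrightarrow> distr \<mu> borel U = \<mu>)"

text \<open>
  The inequality with \<^term>\<open>norm x \<le> norm y\<close> makes \<^term>\<open>f\<close> both radial (equal norms) and
  radially non-increasing. The measure may have an atom at the origin, and the value of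
  \<^term>\<open>f\<close> there is irrelevant. Real values are no restriction for a finite measure.
\<close>

definition isotropic_unimodal_density :: "'a::euclidean_space measure \<Rightarrow> ('a \<Rightarrow> real) \<Rightarrow> bool" where
  "isotropic_unimodal_density \<mu> f \<longleftrightarrow>
     (\<forall>x. x \<noteq> 0 \<longrightarrow> 0 \<le> f x) \<and>
     (\<forall>x y. x \<noteq> 0 \<longrightarrow> norm x \<le> norm y \<longrightarrow> f y \<le> f x) \<and>
     (\<forall>A \<in> sets borel. 0 \<notin> A \<longrightarrow> emeasure \<mu> A = (\<integral>\<^sup>+x\<in>A. ennreal (f x) \<partial>lborel))"

definition isotropic_unimodal :: "'a::euclidean_space measure \<Rightarrow> bool" where
  "isotropic_unimodal \<mu> \<longleftrightarrow> (\<exists>f. isotropic_unimodal_density \<mu> f)"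

locale isotropic_levy_process = levy_process M X
  for M :: "'w measure" and X :: "real \<Rightarrow> 'w \<Rightarrow> 'a::euclidean_space" +
  assumes isotropic: "\<And>t. 0 \<le> t \<Longrightarrow> rotation_invariant (distr M borel (X t))"

locale isotropic_unimodal_levy_process = isotropic_levy_process M X
  for M :: "'w measure" and X :: "real \<Rightarrow> 'w \<Rightarrow> 'a::euclidean_space" +
  assumes unimodal: "\<And>t. 0 < t \<Longrightarrow> isotropic_unimodal (distr M borel (X t))"

definition levy_measure :: "'a::euclidean_space measure \<Rightarrow> bool" where
  "levy_measure \<nu> \<longleftrightarrow> sets \<nu> = sets borel \<and> emeasure \<nu> {0} = 0 \<and>
     (\<integral>\<^sup>+x. ennreal (min 1 ((norm x)\<^sup>2)) \<partial>\<nu>) < \<infinity>"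

definition levy_khintchine_exponent ::
    "'w measure \<Rightarrow> (real \<Rightarrow> 'w \<Rightarrow> 'a::euclidean_space) \<Rightarrow> ('a \<Rightarrow> real) \<Rightarrow> bool" where
  "levy_khintchine_exponent M X \<psi> \<longleftrightarrow>
     (\<forall>t\<ge>0. \<forall>\<xi>. (CLINT x|distr M borel (X t). iexp (\<xi> \<bullet> x)) = complex_of_real (exp (- t * \<psi> \<xi>))) \<and>
     (\<exists>\<eta> \<nu>. 0 \<le> \<eta> \<and> levy_measure \<nu> \<and> rotation_invariant \<nu> \<and>
        (\<forall>\<xi>. \<psi> \<xi> = (LINT x|\<nu>. 1 - cos (\<xi> \<bullet> x)) + \<eta> * (norm \<xi>)\<^sup>2))"

text \<open>The common value of a radial function on the sphere of radius \<^term>\<open>r \<ge> 0\<close>.\<close>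

definition radial_profile :: "('a::euclidean_space \<Rightarrow> real) \<Rightarrow> real \<Rightarrow> real" where
  "radial_profile f r = the_elem (f ` sphere 0 r)"

definition regularly_varying_at_top :: "real \<Rightarrow> (real \<Rightarrow> real) \<Rightarrow> bool" where
  "regularly_varying_at_top \<alpha> f \<longleftrightarrow>
     (\<exists>x\<^sub>0>0. \<forall>x\<ge>x\<^sub>0. 0 < f x) \<and>
     (\<forall>c>0. ((\<lambda>x. f (c * x) / f x) \<longlongrightarrow> c powr \<alpha>) at_top)"

definition limit_constant :: "nat \<Rightarrow> real \<Rightarrow> real" where
  "limit_constant d \<alpha> =
     \<alpha> * 2 powr (\<alpha> - 1) * pi powr (- real d / 2 - 1) * sin (\<alpha> * pi / 2)
       * Gamma (\<alpha> / 2) * Gamma ((real d + \<alpha>) / 2)"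

end

theory Submission
  imports Defs
begin

text \<open>
  Rescale space by \<open>r = |x|\<close> and divide by \<open>s = t \<psi>(1/r)\<close>. The law \<open>\<mu>\<close> of \<open>X\<^sub>t / r\<close> then
  satisfies \<open>(1 - \<integral> cos (\<xi> \<bullet> y) \<mu>(dy)) / s = (1 - exp (- t \<psi>(\<xi>/r))) / s\<close>, and by regular
  variation this tends to \<open>|\<xi>|\<^sup>\<alpha>\<close> when \<open>r\<close> and \<open>s\<close> tend to 0. So away from the origin \<open>\<mu> / s\<close>
  should approach the measure whose exponent is \<open>|\<xi>|\<^sup>\<alpha>\<close>, namely the stable Levy measure with
  density \<open>A |y| powr (-d-\<alpha>)\<close>, where \<open>A\<close> is the constant \<open>limit_constant\<close>. The quotient in the
  theorem is the density of \<open>\<mu> / s\<close> on the unit sphere, and monotonicity of the densities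
  upgrades convergence of measures to convergence of densities there. It is enough to do this
  along sequences, which is \<open>tendsto_unimodal_density\<close>.

  The convergence of measures comes from Laplace transforms in \<open>|y|\<^sup>2\<close>, which turn a problem on
  \<open>\<real>\<^sup>d\<close> into one on the half-line. Averaging the exponent against a standard Gaussian
  gives the limit of \<open>(1 - \<integral> exp (-\<kappa> |y|\<^sup>2) \<mu>(dy)) / s\<close>
  (\<open>tendsto_laplace_transform\<close>). The passage to the limit under the Gaussian integral needs a
  bound that is uniform along the sequence. Potter bounds are avoided:
  \<open>\<Phi> \<xi> = \<integral> (1 - cos (\<xi> \<bullet> y)) \<mu>(dy) / s\<close> satisfies
  \<open>\<Phi>(\<xi> + \<zeta>) \<le> 2 \<Phi>(\<xi>) + 2 \<Phi>(\<zeta>)\<close>, so a Banach-Steinhaus argument turns pointwise boundedness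
  into a common quadratic bound (\<open>quadratic_bound_of_pointwise_bounded\<close>).

  Differences of Laplace transforms at consecutive integers are the moments of \<open>v = exp (-|y|\<^sup>2)\<close>
  under the finite measures \<open>(1 - v) \<mu> / s\<close>. By the Weierstrass theorem, which is Karamata's
  device in Tauberian theory, convergence of these moments gives convergence of the integrals of
  all continuous functions of \<open>v\<close> (\<open>tendsto_integral_of_moments\<close>). A bump function supported in
  a thin shell on one side of the unit sphere then bounds the density on the sphere from above or
  from below. The constant is identified by computing the Laplace transform of the stable Levy
  measure (\<open>laplace_transform_stable_levy_measure\<close>).
\<close>

section \<open>Radial integrals\<close>

text \<open>
  Integration in polar coordinates. The variable \<open>|y|\<^sup>2\<close> is used instead of \<open>|y|\<close> because
  Gaussian integrals become Gamma integrals in it without a further substitution. Both measures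
  give \<open>{..u}\<close> the volume of the ball of radius \<open>sqrt u\<close>.
\<close>

lemma distr_norm_squared_lborel:
  "distr lborel borel (\<lambda>y::'a::euclidean_space. (norm y)\<^sup>2) =
     density lborel (\<lambda>u. ennreal (indicator {0<..} u *
       (unit_ball_vol DIM('a) * (DIM('a) / 2) * u powr (DIM('a) / 2 - 1))))"
    (is "?M = density lborel ?g")
proof (rule measure_eqI_generator_eq[where \<Omega> = UNIV and E = "range atMost" and A = "\<lambda>i. {..real i}"])
  let ?d = "real DIM('a)"
  have lhs: "emeasure ?M {..u} = ennreal (if u \<le> 0 then 0 else unit_ball_vol ?d * u powr (?d / 2))" for u :: real
  proof -
    have "emeasure ?M {..u} = emeasure lborel {y::'a. (norm y)\<^sup>2 \<le> u}"
      by (subst emeasure_distr) (auto simp: vimage_def)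
    also have "{y::'a. (norm y)\<^sup>2 \<le> u} = (if u < 0 then {} else cball 0 (sqrt u))"
    proof (cases "u < 0")
      case True
      then show ?thesis
        using less_le_trans[OF _ zero_le_power2] by (auto simp: not_le)
    next
      case False
      then show ?thesis
        by (auto intro: real_le_rsqrt sqrt_ge_absD)
    qed
    also have "emeasure lborel \<dots> = ennreal (if u \<le> 0 then 0 else unit_ball_vol ?d * u powr (?d / 2))"
    proof -
      have "sqrt u ^ DIM('a) = u powr (?d / 2)" if "0 < u"
        using that by (simp add: powr_half_sqrt[symmetric] powr_powr flip: powr_realpow)
      then show ?thesis
        by (cases "u = 0") (auto simp: emeasure_cball)
    qed
    finally show ?thesis .
  qed
  have rhs: "emeasure (density lborel ?g) {..u} = ennreal (if u \<le> 0 then 0 else unit_ball_vol ?d * u powr (?d / 2))" for u :: real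
  proof (cases "u \<le> 0")
    case True
    then show ?thesis
      by (subst emeasure_density) (auto intro!: nn_integral_zero' AE_I2 split: split_indicator)
  next
    case False
    have d: "0 < ?d" by simp
    have *: "((\<lambda>x. unit_ball_vol ?d * (?d/2) * x powr (?d/2 - 1)) has_integral 
         unit_ball_vol ?d * (?d/2) * (u powr (?d/2-1+1) / (?d/2-1+1))) {0..u}"
      by (intro has_integral_mult_right has_integral_powr_from_0) (use False d in auto)
    have "emeasure (density lborel ?g) {..u} = (\<integral>\<^sup>+x. ?g x * indicator {..u} x \<partial>lborel)"
      by (subst emeasure_density) auto
    also have "\<dots> = (\<integral>\<^sup>+x. ennreal (indicator {0..u} x * (unit_ball_vol ?d * (?d/2) * x powr (?d/2 - 1))) \<partial>lborel)"
      by (intro nn_integral_cong) (auto split: split_indicator)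
    also have "\<dots> = ennreal (unit_ball_vol ?d * (?d/2) * (u powr (?d/2-1+1) / (?d/2-1+1)))"
      by (rule nn_integral_has_integral_lebesgue[OF _ *]) auto
    finally show ?thesis using False by simp
  qed
  show "emeasure ?M X = emeasure (density lborel ?g) X" if "X \<in> range atMost" for X
    using that lhs rhs by auto
  show "emeasure ?M {..real i} \<noteq> \<infinity>" for i by (simp add: lhs)
  show "Int_stable (range (atMost :: real \<Rightarrow> _))"
    by (auto simp: Int_stable_def) 
  show "sets ?M = sigma_sets UNIV (range atMost)" "sets (density lborel ?g) = sigma_sets UNIV (range atMost)"
    using arg_cong[OF borel_eq_atMost[where 'a=real], of sets] by (simp_all add: image_def)
  show "(\<Union>i. {..real i}) = UNIV"
    by (auto intro: real_arch_simple)
qed auto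

lemma nn_integral_norm_squared:
  assumes [measurable]: "f \<in> borel_measurable borel"
  shows "(\<integral>\<^sup>+y. f ((norm (y::'a::euclidean_space))\<^sup>2) \<partial>lborel) =
    (\<integral>\<^sup>+u. ennreal (indicator {0<..} u * (unit_ball_vol DIM('a) * (DIM('a) / 2) * u powr (DIM('a) / 2 - 1))) * f u \<partial>lborel)"
proof -
  have "(\<integral>\<^sup>+y. f ((norm (y::'a))\<^sup>2) \<partial>lborel) = (\<integral>\<^sup>+u. f u \<partial>distr lborel borel (\<lambda>y::'a. (norm y)\<^sup>2))"
    by (subst nn_integral_distr) auto
  then show ?thesis
    by (simp add: distr_norm_squared_lborel nn_integral_density)
qed

lemma nn_integral_Gamma_scaled:
  assumes "0 < s" "0 < (c::real)"
  shows "(\<integral>\<^sup>+u. ennreal (indicator {0<..} u * (u powr (s - 1) * exp (- c * u))) \<partial>lborel) = ennreal (Gamma s * c powr (- s))"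
proof -
  have "Gamma s = (\<integral>\<^sup>+t. ennreal (indicator {0..} t * t powr (s - 1) / exp t) \<partial>lborel)"
    by (rule Gamma_conv_nn_integral_real) fact
  also have "\<dots> = ennreal c * (\<integral>\<^sup>+u. ennreal (indicator {0..} (0 + c * u) * (0 + c * u) powr (s - 1) / exp (0 + c * u)) \<partial>lborel)"
    using assms by (subst nn_integral_real_affine[where c=c and t=0]) auto
  also have "(\<integral>\<^sup>+u. ennreal (indicator {0..} (0 + c * u) * (0 + c * u) powr (s - 1) / exp (0 + c * u)) \<partial>lborel)
     = (\<integral>\<^sup>+u. ennreal (c powr (s - 1)) * ennreal (indicator {0<..} u * (u powr (s - 1) * exp (- c * u))) \<partial>lborel)"
    using assms
    by (intro nn_integral_cong)
       (auto simp: ennreal_mult'[symmetric] powr_mult exp_minus field_simps zero_le_mult_iff indicator_def)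
  also have "\<dots> = ennreal (c powr (s - 1)) * (\<integral>\<^sup>+u. ennreal (indicator {0<..} u * (u powr (s - 1) * exp (- c * u))) \<partial>lborel)"
    (is "_ = _ * ?I") by (rule nn_integral_cmult) auto
  also have "ennreal c * (ennreal (c powr (s - 1)) * ?I) = ennreal (c powr s) * ?I"
    using assms by (simp add: mult.assoc[symmetric] ennreal_mult'[symmetric] powr_diff)
  finally have "ennreal (c powr (- s)) * ennreal (Gamma s) = ennreal (c powr (- s)) * (ennreal (c powr s) * ?I)"
    by simp
  also have "\<dots> = ?I"
    using assms by (simp add: mult.assoc[symmetric] ennreal_mult'[symmetric] powr_add[symmetric])
  finally show ?thesis
    using assms by (simp add: ennreal_mult'[symmetric] mult.commute)
qed

text \<open>
  This single formula gives both the moments of the Gaussian distribution (\<open>c = 1/2\<close>) and, through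
  its dependence on \<open>c\<close>, the Laplace transform of the stable Levy measure
  (\<open>p = 2 - d - \<alpha>\<close>).
\<close>

lemma nn_integral_gaussian_moment:
  fixes c p :: real
  assumes "- real DIM('a::euclidean_space) < p" "0 < c"
  shows "(\<integral>\<^sup>+y. ennreal (norm (y::'a) powr p * exp (- c * (norm y)\<^sup>2)) \<partial>lborel)
    = ennreal (pi powr (DIM('a) / 2) * Gamma ((DIM('a) + p) / 2) / Gamma (DIM('a) / 2) * c powr (- (DIM('a) + p) / 2))"
proof -
  let ?d = "real DIM('a)"
  define K where "K = unit_ball_vol ?d * (?d / 2)"
  have K: "0 \<le> K" by (simp add: K_def)
  have d: "0 < ?d" by simp
  have "(\<integral>\<^sup>+y. ennreal (norm (y::'a) powr p * exp (- c * (norm y)\<^sup>2)) \<partial>lborel)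
      = (\<integral>\<^sup>+y. (\<lambda>u. ennreal (u powr (p / 2) * exp (- c * u))) ((norm (y::'a))\<^sup>2) \<partial>lborel)"
    by (intro nn_integral_cong)
       (auto simp: powr_powr simp flip: powr_numeral)
  also have "\<dots> = (\<integral>\<^sup>+u. ennreal K * ennreal (indicator {0<..} u * (u powr ((?d + p) / 2 - 1) * exp (- c * u))) \<partial>lborel)"
    using K unfolding K_def
    by (subst nn_integral_norm_squared)
       (auto intro!: nn_integral_cong simp: ennreal_mult'[symmetric] powr_add[symmetric] indicator_def add_divide_distrib algebra_simps)
  also have "\<dots> = ennreal K * ennreal (Gamma ((?d + p) / 2) * c powr (- ((?d + p) / 2)))"
    using assms nn_integral_Gamma_scaled[of "(?d + p) / 2" c] by (subst nn_integral_cmult) auto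
  also have "\<dots> = ennreal (K * (Gamma ((?d + p) / 2) * c powr (- ((?d + p) / 2))))"
    using K by (simp add: ennreal_mult')
  also have "K = pi powr (?d / 2) / Gamma (?d / 2)"
  proof -
    have "?d / 2 \<notin> \<int>\<^sub>\<le>\<^sub>0"
      using d by (meson half_gt_zero nonpos_Ints_nonpos not_le)
    then show ?thesis
      using d Gamma_real_pos[of "?d / 2"] by (simp add: K_def unit_ball_vol_def Gamma_plus1)
  qed
  finally show ?thesis by (simp add: minus_divide_left mult.assoc)
qed

section \<open>The standard Gaussian distribution\<close>

text \<open>
  Fubini in complex-valued form, as needed for characteristic functions.
\<close>

lemma integral_lborel_prod_Basis:
  fixes f :: "'a::euclidean_space \<Rightarrow> real \<Rightarrow> complex"
  assumes f: "\<And>b. b \<in> Basis \<Longrightarrow> integrable lborel (f b)"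
  shows "(CLINT x|lborel. \<Prod>b\<in>Basis. f b (x \<bullet> b)) = (\<Prod>b\<in>Basis. CLINT y|lborel. f b y)"
proof -
  interpret product_sigma_finite "\<lambda>_::'a. lborel :: real measure"
    by standard
  have [measurable]: "f b \<in> borel_measurable borel" if "b \<in> Basis" for b
    using borel_measurable_integrable[OF f[OF that]] by simp
  have "(CLINT x|lborel. \<Prod>b\<in>Basis. f b (x \<bullet> b))
      = (CLINT x|(\<Pi>\<^sub>M b\<in>(Basis::'a set). lborel). \<Prod>b\<in>Basis. f b ((\<Sum>b\<in>Basis. x b *\<^sub>R b) \<bullet> b))"
    by (subst lborel_eq, subst integral_distr) auto
  also have "\<dots> = (CLINT x|(\<Pi>\<^sub>M b\<in>(Basis::'a set). lborel). \<Prod>b\<in>Basis. f b (x b))"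
    by (intro Bochner_Integration.integral_cong prod.cong refl)
       (auto simp: inner_sum_left inner_Basis if_distrib cong: if_cong)
  also have "\<dots> = (\<Prod>b\<in>Basis. CLINT y|lborel. f b y)"
    using f by (intro product_integral_prod) auto
  finally show ?thesis .
qed

definition std_gaussian :: "'a::euclidean_space measure" where
  "std_gaussian = density lborel (\<lambda>x. ennreal ((2 * pi) powr (- DIM('a) / 2) * exp (- (norm x)\<^sup>2 / 2)))"

lemma sets_std_gaussian [measurable_cong, simp]: "sets std_gaussian = sets borel"
  and space_std_gaussian [simp]: "space std_gaussian = UNIV"
  by (simp_all add: std_gaussian_def)

lemma sum_Basis_square_half:
  "(\<Sum>b\<in>Basis. - (x \<bullet> b)\<^sup>2 / 2) = - (norm (x :: 'a::euclidean_space))\<^sup>2 / 2"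
proof -
  have "(\<Sum>b\<in>Basis. - (x \<bullet> b)\<^sup>2 / 2) = - (\<Sum>b\<in>Basis. (x \<bullet> b) * (x \<bullet> b)) / 2"
    by (simp add: sum_negf power2_eq_square flip: sum_divide_distrib)
  then show ?thesis
    by (simp only: power2_norm_eq_inner euclidean_inner[of x x])
qed

text \<open>
  The product form lets the characteristic function and the total mass be computed coordinatewise.
\<close>

lemma std_gaussian_density_prod:
  "(\<Prod>b\<in>Basis. std_normal_density (x \<bullet> b)) =
     (2 * pi) powr (- DIM('a) / 2) * exp (- (norm (x :: 'a::euclidean_space))\<^sup>2 / 2)"
proof -
  have "(\<Prod>b\<in>(Basis::'a set). std_normal_density (x \<bullet> b)) =
      (1 / sqrt (2 * pi)) ^ DIM('a) * exp (\<Sum>b\<in>Basis. - (x \<bullet> b)\<^sup>2 / 2)"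
    by (simp add: std_normal_density_def prod.distrib exp_sum prod_dividef power_divide)
  also have "(\<Sum>b\<in>Basis. - (x \<bullet> b)\<^sup>2 / 2) = - (norm x)\<^sup>2 / 2"
    by (rule sum_Basis_square_half)
  also have "(1 / sqrt (2 * pi)) ^ DIM('a) = (2 * pi) powr (- DIM('a) / 2)"
  proof -
    have "1 / sqrt (2 * pi) = (2 * pi) powr (- 1 / 2)"
      by (simp add: powr_minus_divide powr_half_sqrt)
    moreover have "((2 * pi) powr (- 1 / 2)) ^ DIM('a) = ((2 * pi) powr (- 1 / 2)) powr DIM('a)"
      by (rule powr_realpow[symmetric]) simp
    ultimately show ?thesis
      by (simp add: powr_powr)
  qed
  finally show ?thesis .
qed

lemma char_std_gaussian:
  "(CLINT x|std_gaussian. iexp (t \<bullet> x)) = complex_of_real (exp (- (norm (t::'a::euclidean_space))\<^sup>2 / 2))"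
proof -
  define f where "f b y = complex_of_real (std_normal_density y) * iexp ((t \<bullet> b) * y)" for b :: 'a and y
  have [measurable]: "f b \<in> borel_measurable borel" for b
    unfolding f_def[abs_def] by measurable
  have int: "integrable lborel (f b)" for b
    by (rule Bochner_Integration.integrable_bound[OF integrable_normal_density[of 1 0]])
       (auto simp: f_def norm_mult)
  have iexp: "iexp (t \<bullet> x) = (\<Prod>b\<in>Basis. iexp ((t \<bullet> b) * (x \<bullet> b)))" for x
    by (subst euclidean_inner) (simp add: exp_sum sum_distrib_left)
  have "(CLINT x|std_gaussian. iexp (t \<bullet> x))
      = (CLINT x|lborel. (\<Prod>b\<in>Basis. std_normal_density (x \<bullet> b)) *\<^sub>R iexp (t \<bullet> x))"
    unfolding std_gaussian_def std_gaussian_density_prod[symmetric]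
    by (rule integral_density) (auto intro!: prod_nonneg AE_I2)
  also have "\<dots> = (CLINT x|lborel. \<Prod>b\<in>Basis. f b (x \<bullet> b))"
    by (simp add: f_def prod.distrib scaleR_conv_of_real iexp)
  also have "\<dots> = (\<Prod>b\<in>Basis. CLINT y|lborel. f b y)"
    by (rule integral_lborel_prod_Basis[OF int])
  also have "\<dots> = (\<Prod>b\<in>Basis. char std_normal_distribution (t \<bullet> b))"
    unfolding f_def char_def
    by (subst integral_density) (auto simp: scaleR_conv_of_real normal_density_nonneg)
  also have "\<dots> = complex_of_real (exp (\<Sum>b\<in>Basis. - (t \<bullet> b)\<^sup>2 / 2))"
    by (simp add: char_std_normal_distribution exp_sum exp_of_real[symmetric] del: exp_of_real)
  also have "(\<Sum>b\<in>Basis. - (t \<bullet> b)\<^sup>2 / 2) = - (norm t)\<^sup>2 / 2"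
    by (rule sum_Basis_square_half)
  finally show ?thesis .
qed

lemma prob_space_std_gaussian: "prob_space (std_gaussian :: 'a::euclidean_space measure)"
proof
  have "emeasure std_gaussian (space (std_gaussian::'a measure)) = 
     (\<integral>\<^sup>+x. (\<Prod>b\<in>Basis. ennreal (std_normal_density ((x::'a) \<bullet> b))) \<partial>lborel)"
    unfolding std_gaussian_def std_gaussian_density_prod[symmetric]
    by (simp add: emeasure_density prod_ennreal)
  also have "\<dots> = 1"
    by (subst nn_integral_lborel_prod) 
      (use prob_space.emeasure_space_1[OF prob_space_normal_density[of 1 0]] in \<open>auto simp: emeasure_density\<close>)
  finally show "emeasure std_gaussian (space (std_gaussian::'a measure)) = 1" .
qed

lemma integral_cos_std_gaussian:
  "(LINT x|std_gaussian. cos (t \<bullet> x)) = exp (- (norm (t::'a::euclidean_space))\<^sup>2 / 2)"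
proof -
  interpret prob_space "std_gaussian :: 'a measure" by (rule prob_space_std_gaussian)
  have "integrable std_gaussian (\<lambda>x. iexp (t \<bullet> x))"
    by (rule integrable_const_bound[where B = 1]) auto
  from integral_Re[OF this] show ?thesis
    by (simp add: char_std_gaussian Re_exp del: of_real_exp)
qed

lemma std_gaussian_norm_powr:
  fixes p :: real
  assumes p: "- real DIM('a::euclidean_space) < p"
  shows "has_bochner_integral std_gaussian (\<lambda>x::'a. norm x powr p)
           (2 powr (p / 2) * Gamma ((DIM('a) + p) / 2) / Gamma (DIM('a) / 2))"
proof -
  let ?d = "real DIM('a)"
  have d: "0 < ?d" by simp
  let ?v = "2 powr (p / 2) * Gamma ((?d + p) / 2) / Gamma (?d / 2)"
  have "(\<integral>\<^sup>+x. ennreal (norm (x::'a) powr p) \<partial>std_gaussian)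
    = (\<integral>\<^sup>+x. ennreal ((2 * pi) powr (- ?d / 2)) * ennreal (norm (x::'a) powr p * exp (- (1/2) * (norm x)\<^sup>2)) \<partial>lborel)"
    unfolding std_gaussian_def
    by (subst nn_integral_density) (auto intro!: nn_integral_cong simp: ennreal_mult'[symmetric] mult_ac)
  also have "\<dots> = ennreal ((2 * pi) powr (- ?d / 2)) * ennreal (pi powr (?d / 2) * Gamma ((?d + p) / 2) / Gamma (?d / 2) * (1/2) powr (- (?d + p) / 2))"
    using p by (subst nn_integral_cmult) (auto simp only: nn_integral_gaussian_moment zero_less_divide_1_iff zero_less_numeral, measurable)
  also have "\<dots> = ennreal ?v"
  proof -
    have "(2 * pi) powr (- ?d / 2) = 2 powr (- ?d / 2) * pi powr (- ?d / 2)"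
      by (simp add: powr_mult)
    moreover have "(1 / 2) powr (- (?d + p) / 2) = 2 powr (?d / 2) * 2 powr (p / 2)"
      by (simp add: powr_divide add_divide_distrib diff_divide_distrib add.commute flip: powr_add powr_minus_divide)
    ultimately have "(2 * pi) powr (- ?d / 2) * (pi powr (?d / 2) * Gamma ((?d + p) / 2) / Gamma (?d / 2) * (1/2) powr (- (?d + p) / 2))
        = (2 powr (- ?d / 2) * 2 powr (?d / 2)) * (pi powr (- ?d / 2) * pi powr (?d / 2)) * ?v"
      by (simp add: mult_ac)
    also have "\<dots> = ?v"
      by (simp flip: powr_add)
    finally show ?thesis
      by (simp only: ennreal_mult'[symmetric] powr_ge_zero)
  qed
  finally have nn: "(\<integral>\<^sup>+x. ennreal (norm (x::'a) powr p) \<partial>std_gaussian) = ennreal ?v" .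
  have "0 < Gamma ((?d + p) / 2)" "0 < Gamma (?d / 2)"
    using p d by (auto intro!: Gamma_real_pos)
  then show ?thesis
    by (intro has_bochner_integral_nn_integral[OF _ _ _ nn]) (auto intro!: divide_nonneg_nonneg)
qed

section \<open>A uniform bound for exponents\<close>

text \<open>
  The sets on which all functions are bounded by \<open>k\<close> are closed and cover the space, so by Baire
  one of them has interior.
\<close>

lemma pointwise_bounded_imp_bounded_on_ball:
  fixes \<Phi> :: "nat \<Rightarrow> 'a::euclidean_space \<Rightarrow> real"
  assumes cont: "\<And>n. continuous_on UNIV (\<Phi> n)"
    and bdd: "\<And>\<xi>. \<exists>K. \<forall>n. \<Phi> n \<xi> \<le> K"
  shows "\<exists>a \<rho> K. 0 < \<rho> \<and> (\<forall>n. \<forall>\<xi>\<in>ball a \<rho>. \<Phi> n \<xi> \<le> K)"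
proof -
  define E where "E k = {\<xi>. \<forall>n. \<Phi> n \<xi> \<le> real k}" for k :: nat
  have closed: "closed (E k)" for k
    unfolding E_def by (intro closed_Collect_all closed_Collect_le cont continuous_on_const)
  have "\<exists>k. interior (E k) \<noteq> {}"
  proof (rule ccontr)
    assume "\<not> ?thesis"
    then have int: "interior (E k) = {}" for k by auto
    have "UNIV \<subseteq> closure (\<Inter>(range (\<lambda>k. - E k)))"
      by (rule Baire) (use closed int in \<open>auto simp: closure_complement\<close>)
    moreover have "\<Inter>(range (\<lambda>k. - E k)) = {}"
    proof -
      have "\<exists>k. \<xi> \<in> E k" for \<xi>
        using bdd[of \<xi>] by (auto simp: E_def) (meson order_trans real_arch_simple)
      then show ?thesis by auto
    qed
    ultimately show False by simp
  qed
  then obtain k a where "a \<in> interior (E k)" by auto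
  then obtain \<rho> where "0 < \<rho>" "ball a \<rho> \<subseteq> E k" by (auto simp: mem_interior)
  then show ?thesis by (fastforce simp: E_def)
qed

text \<open>
  This is the Banach-Steinhaus argument with \<open>subadd\<close> in place of linearity. A bound on some ball
  gives a bound on a ball around 0, since \<open>\<xi> = (a + \<xi>) - a\<close>; and doubling the radius costs a
  factor 4, which is quadratic growth.
\<close>

lemma quadratic_bound_of_pointwise_bounded:
  fixes \<Phi> :: "nat \<Rightarrow> 'a::euclidean_space \<Rightarrow> real"
  assumes cont: "\<And>n. continuous_on UNIV (\<Phi> n)"
    and bdd: "\<And>\<xi>. \<exists>K. \<forall>n. \<Phi> n \<xi> \<le> K"
    and even: "\<And>n \<xi>. \<Phi> n (- \<xi>) = \<Phi> n \<xi>"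
    and subadd: "\<And>n \<xi> \<zeta>. \<Phi> n (\<xi> + \<zeta>) \<le> 2 * \<Phi> n \<xi> + 2 * \<Phi> n \<zeta>"
  shows "\<exists>B. \<forall>n \<xi>. \<Phi> n \<xi> \<le> B * (1 + (norm \<xi>)\<^sup>2)"
proof -
  obtain a \<rho> K where "0 < \<rho>" and K: "\<And>n \<xi>. \<xi> \<in> ball a \<rho> \<Longrightarrow> \<Phi> n \<xi> \<le> K"
    using pointwise_bounded_imp_bounded_on_ball[OF cont bdd] by blast
  define D where "D = max 1 (4 * K)"
  have ball: "\<Phi> n \<xi> \<le> D" if "norm \<xi> < \<rho>" for n \<xi>
  proof -
    have "\<Phi> n \<xi> \<le> 2 * \<Phi> n (a + \<xi>) + 2 * \<Phi> n a"
      using subadd[of n "a + \<xi>" "- a"] by (simp add: even)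
    then show ?thesis
      using K[of "a + \<xi>" n] K[of a n] that \<open>0 < \<rho>\<close> by (simp add: D_def dist_norm)
  qed
  have double: "\<Phi> n \<xi> \<le> 4 ^ j * D" if "norm \<xi> < 2 ^ j * \<rho>" for n \<xi> j
    using that
  proof (induction j arbitrary: \<xi>)
    case 0
    then show ?case using ball by simp
  next
    case (Suc j)
    have "\<Phi> n \<xi> \<le> 4 * \<Phi> n ((1/2) *\<^sub>R \<xi>)"
      using subadd[of n "(1/2) *\<^sub>R \<xi>" "(1/2) *\<^sub>R \<xi>"] by (simp flip: scaleR_add_left)
    also have "\<Phi> n ((1/2) *\<^sub>R \<xi>) \<le> 4 ^ j * D"
      using Suc.prems by (intro Suc.IH) simp
    finally show ?case by simp
  qed
  have "\<Phi> n \<xi> \<le> D * (1 + 4 / \<rho>\<^sup>2) * (1 + (norm \<xi>)\<^sup>2)" for n \<xi>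
  proof (cases "norm \<xi> < \<rho>")
    case True
    have "D * 1 \<le> D * ((1 + 4 / \<rho>\<^sup>2) * (1 + (norm \<xi>)\<^sup>2))"
      by (intro mult_left_mono) (auto simp: D_def algebra_simps)
    with ball[OF True, of n] show ?thesis by (simp add: mult.assoc)
  next
    case False
    \<comment> \<open>the first dyadic multiple of the ball that contains \<open>\<xi>\<close>, so that \<open>4 ^ j\<close> is of order \<open>|\<xi>|\<^sup>2\<close>\<close>
    define j where "j = (LEAST j. norm \<xi> < 2 ^ j * \<rho>)"
    have "\<exists>j. norm \<xi> < 2 ^ j * \<rho>"
      using real_arch_pow[of 2 "norm \<xi> / \<rho>"] \<open>0 < \<rho>\<close> by (auto simp: field_simps)
    then have j: "norm \<xi> < 2 ^ j * \<rho>"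
      unfolding j_def by (rule LeastI_ex)
    have "j \<noteq> 0" using j False by (cases j) auto
    then obtain i where i: "j = Suc i" by (cases j) auto
    have "\<not> norm \<xi> < 2 ^ i * \<rho>"
      using not_less_Least[of i "\<lambda>j. norm \<xi> < 2 ^ j * \<rho>"] i by (simp add: j_def)
    then have "(2 ^ i * \<rho>)\<^sup>2 \<le> (norm \<xi>)\<^sup>2"
      using \<open>0 < \<rho>\<close> by (intro power_mono) auto
    then have "4 ^ i * \<rho>\<^sup>2 \<le> (norm \<xi>)\<^sup>2"
      by (simp add: power_mult_distrib power_mult[symmetric] mult.commute[of i]) (simp add: power_mult)
    then have "4 ^ j \<le> 4 / \<rho>\<^sup>2 * (norm \<xi>)\<^sup>2"
      using \<open>0 < \<rho>\<close> by (simp add: i field_simps)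
    also have "\<dots> \<le> (1 + 4 / \<rho>\<^sup>2) * (1 + (norm \<xi>)\<^sup>2)"
      by (intro mult_mono) auto
    finally have "4 ^ j * D \<le> (1 + 4 / \<rho>\<^sup>2) * (1 + (norm \<xi>)\<^sup>2) * D"
      by (intro mult_right_mono) (auto simp: D_def)
    with double[OF j, of n] show ?thesis by (simp add: mult_ac)
  qed
  then show ?thesis by blast
qed

text \<open>
  In terms of \<open>1 - cos x = 2 sin\<^sup>2 (x/2)\<close> this is \<open>|sin (a + b)| \<le> |sin a| + |sin b|\<close> squared.
\<close>

lemma one_minus_cos_add_le: "1 - cos (a + b) \<le> 2 * (1 - cos a) + 2 * (1 - cos (b::real))"
proof -
  have h: "1 - cos x = 2 * (sin (x / 2))\<^sup>2" for x :: real
    using cos_double_sin[of "x / 2"] by simp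
  have "(sin (a/2 + b/2))\<^sup>2 \<le> 2 * (sin (a/2))\<^sup>2 + 2 * (sin (b/2))\<^sup>2"
  proof -
    have "\<bar>sin (a/2 + b/2)\<bar> \<le> \<bar>sin (a/2)\<bar> * \<bar>cos (b/2)\<bar> + \<bar>cos (a/2)\<bar> * \<bar>sin (b/2)\<bar>"
      unfolding sin_add by (metis abs_mult abs_triangle_ineq)
    also have "\<dots> \<le> \<bar>sin (a/2)\<bar> + \<bar>sin (b/2)\<bar>"
      by (intro add_mono mult_left_le mult_right_le_one_le mult_left_le_one_le) auto
    finally have "\<bar>sin (a/2 + b/2)\<bar>\<^sup>2 \<le> (\<bar>sin (a/2)\<bar> + \<bar>sin (b/2)\<bar>)\<^sup>2"
      by (intro power_mono) auto
    also have "\<dots> \<le> 2 * (sin (a/2))\<^sup>2 + 2 * (sin (b/2))\<^sup>2"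
      using zero_le_power2[of "\<bar>sin (a/2)\<bar> - \<bar>sin (b/2)\<bar>"] by (simp add: power2_sum power2_diff)
    finally show ?thesis by simp
  qed
  then show ?thesis by (simp add: h add_divide_distrib)
qed

lemma continuous_on_integral_cos:
  fixes \<mu> :: "'a::euclidean_space measure"
  assumes "prob_space \<mu>" and [measurable_cong]: "sets \<mu> = sets borel"
  shows "continuous_on UNIV (\<lambda>\<xi>. LINT x|\<mu>. cos (\<xi> \<bullet> x))"
proof -
  interpret prob_space \<mu> by fact
  show ?thesis
    unfolding continuous_on_sequentially
  proof (intro allI ballI impI)
    fix u :: "nat \<Rightarrow> 'a" and \<xi> assume u: "(\<forall>n. u n \<in> UNIV) \<and> u \<longlonglongrightarrow> \<xi>"
    show "((\<lambda>\<xi>. LINT x|\<mu>. cos (\<xi> \<bullet> x)) \<circ> u) \<longlonglongrightarrow> (LINT x|\<mu>. cos (\<xi> \<bullet> x))"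
      unfolding comp_def
      by (rule integral_dominated_convergence[where w = "\<lambda>_. 1"])
        (use u in \<open>auto intro!: tendsto_intros\<close>)
  qed
qed

text \<open>
  The Gaussian is its own Fourier transform, so an integral of \<open>exp (- c\<^sup>2 |y|\<^sup>2 / 2)\<close> is a Gaussian
  average of characteristic functions.
\<close>

lemma integral_gaussian_eq_integral_cos:
  fixes \<mu> :: "'a::euclidean_space measure"
  assumes "prob_space \<mu>" and [measurable_cong]: "sets \<mu> = sets borel"
  shows "(LINT y|\<mu>. exp (- (norm (c *\<^sub>R y))\<^sup>2 / 2)) = (LINT \<xi>|std_gaussian. LINT y|\<mu>. cos ((c *\<^sub>R \<xi>) \<bullet> y))"
proof -
  interpret \<mu>: prob_space \<mu> by fact
  interpret G: prob_space "std_gaussian :: 'a measure" by (rule prob_space_std_gaussian)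
  interpret P: pair_prob_space \<mu> "std_gaussian :: 'a measure" ..
  have "(LINT y|\<mu>. exp (- (norm (c *\<^sub>R y))\<^sup>2 / 2)) = (LINT y|\<mu>. LINT \<xi>|std_gaussian. cos ((c *\<^sub>R \<xi>) \<bullet> y))"
    using integral_cos_std_gaussian[of "c *\<^sub>R y" for y :: 'a]
    by (simp add: inner_commute)
  also have "\<dots> = (LINT \<xi>|std_gaussian. LINT y|\<mu>. cos ((c *\<^sub>R \<xi>) \<bullet> y))"
    by (intro P.Fubini_integral[symmetric] P.integrable_const_bound[where B = 1]) auto
  finally show ?thesis .
qed

section \<open>Limits of Laplace transforms\<close>

text \<open>
  Here \<open>\<Phi> n\<close> is the rescaled exponent. The Laplace transform at \<open>\<kappa>\<close> is its Gaussian average at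
  scale \<open>c = sqrt (2 \<kappa>)\<close>, because \<open>|c y|\<^sup>2 / 2 = \<kappa> |y|\<^sup>2\<close>. The common quadratic bound on the \<open>\<Phi> n\<close>
  permits dominated convergence, and the limit is a Gaussian moment of order \<open>\<alpha>\<close>.
\<close>

lemma tendsto_laplace_transform:
  fixes \<mu> :: "nat \<Rightarrow> 'a::euclidean_space measure" and s :: "nat \<Rightarrow> real"
    and \<alpha> \<kappa> :: real
  assumes prob: "\<And>n. prob_space (\<mu> n)" and sets: "\<And>n. sets (\<mu> n) = sets borel"
    and s: "\<And>n. 0 < s n" and \<alpha>: "0 < \<alpha>"
    and lim: "\<And>\<xi>. (\<lambda>n. (1 - (LINT y|\<mu> n. cos (\<xi> \<bullet> y))) / s n) \<longlonglongrightarrow> norm \<xi> powr \<alpha>"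
    and \<kappa>: "0 \<le> \<kappa>"
  shows "(\<lambda>n. (1 - (LINT y|\<mu> n. exp (- \<kappa> * (norm y)\<^sup>2))) / s n) \<longlonglongrightarrow>
           2 powr \<alpha> * Gamma ((DIM('a) + \<alpha>) / 2) / Gamma (DIM('a) / 2) * \<kappa> powr (\<alpha> / 2)"
proof -
  note [measurable_cong] = sets
  let ?\<gamma> = "std_gaussian :: 'a measure"
  let ?d = "real DIM('a)"
  define c where "c = sqrt (2 * \<kappa>)"
  define \<Phi> where "\<Phi> n \<xi> = (1 - (LINT y|\<mu> n. cos (\<xi> \<bullet> y))) / s n" for n and \<xi> :: 'a
  interpret G: prob_space ?\<gamma> by (rule prob_space_std_gaussian)
  have int_cos: "integrable (\<mu> n) (\<lambda>y. cos (\<xi> \<bullet> y))" for n \<xi>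
  proof -
    interpret prob_space "\<mu> n" by (rule prob)
    show ?thesis by (rule integrable_const_bound[where B = 1]) auto
  qed
  have \<Phi>_eq: "\<Phi> n \<xi> = (LINT y|\<mu> n. 1 - cos (\<xi> \<bullet> y)) / s n" for n \<xi>
  proof -
    interpret prob_space "\<mu> n" by (rule prob)
    show ?thesis by (simp add: \<Phi>_def int_cos prob_space)
  qed
  have int1: "integrable (\<mu> n) (\<lambda>y. 1 - cos (\<xi> \<bullet> y))" for n \<xi>
  proof -
    interpret prob_space "\<mu> n" by (rule prob)
    show ?thesis by (simp add: int_cos)
  qed
  have cont: "continuous_on UNIV (\<Phi> n)" for n
    unfolding \<Phi>_def[abs_def] using s[of n]
    by (intro continuous_intros continuous_on_integral_cos prob sets) auto
  have "\<exists>B. \<forall>n \<xi>. \<Phi> n \<xi> \<le> B * (1 + (norm \<xi>)\<^sup>2)"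
  proof (rule quadratic_bound_of_pointwise_bounded[OF cont])
    show "\<exists>K. \<forall>n. \<Phi> n \<xi> \<le> K" for \<xi>
    proof -
      have "Bseq (\<lambda>n. \<Phi> n \<xi>)"
        unfolding \<Phi>_def using lim[of \<xi>] by (intro convergent_imp_Bseq convergentI)
      then show ?thesis
        unfolding Bseq_def real_norm_def by (meson abs_ge_self order_trans)
    qed
    show "\<Phi> n (- \<xi>) = \<Phi> n \<xi>" for n \<xi>
      by (simp add: \<Phi>_def)
    show "\<Phi> n (\<xi> + \<zeta>) \<le> 2 * \<Phi> n \<xi> + 2 * \<Phi> n \<zeta>" for n \<xi> \<zeta>
    proof -
      have "(LINT y|\<mu> n. 1 - cos ((\<xi> + \<zeta>) \<bullet> y)) \<le> (LINT y|\<mu> n. 2 * (1 - cos (\<xi> \<bullet> y)) + 2 * (1 - cos (\<zeta> \<bullet> y)))"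
        by (intro integral_mono Bochner_Integration.integrable_add integrable_mult_right int1)
           (unfold inner_add_left, rule one_minus_cos_add_le)
      also have "\<dots> = 2 * (LINT y|\<mu> n. 1 - cos (\<xi> \<bullet> y)) + 2 * (LINT y|\<mu> n. 1 - cos (\<zeta> \<bullet> y))"
        using int1 by (subst Bochner_Integration.integral_add) (auto simp only: integrable_mult_right integral_mult_right_zero)
      finally show ?thesis
        using s[of n] unfolding \<Phi>_eq
        by (simp only: times_divide_eq_right add_divide_distrib[symmetric]) (intro divide_right_mono; simp)
    qed
  qed
  then obtain B where B: "\<Phi> n \<xi> \<le> B * (1 + (norm \<xi>)\<^sup>2)" for n \<xi> by blast
  have \<Phi>_nonneg: "0 \<le> \<Phi> n \<xi>" for n \<xi>
    unfolding \<Phi>_eq using s[of n] by (intro divide_nonneg_pos Bochner_Integration.integral_nonneg) auto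
  have meas: "(\<lambda>\<xi>. \<Phi> n (c *\<^sub>R \<xi>)) \<in> borel_measurable ?\<gamma>" for n
  proof -
    have [measurable]: "\<Phi> n \<in> borel_measurable borel"
      using cont by (rule borel_measurable_continuous_onI)
    show ?thesis by measurable
  qed
  have sq: "integrable ?\<gamma> (\<lambda>\<xi>. (norm \<xi>)\<^sup>2)"
    using std_gaussian_norm_powr[where 'a='a, of 2] by (simp add: has_bochner_integral_iff)
  have lim_int: "(\<lambda>n. LINT \<xi>|?\<gamma>. \<Phi> n (c *\<^sub>R \<xi>)) \<longlonglongrightarrow> (LINT \<xi>|?\<gamma>. norm (c *\<^sub>R \<xi>) powr \<alpha>)"
  proof (rule integral_dominated_convergence[where w = "\<lambda>\<xi>. B * (1 + c\<^sup>2 * (norm \<xi>)\<^sup>2)"])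
    show "integrable ?\<gamma> (\<lambda>\<xi>. B * (1 + c\<^sup>2 * (norm \<xi>)\<^sup>2))"
      using sq by auto
    show "AE \<xi> in ?\<gamma>. (\<lambda>n. \<Phi> n (c *\<^sub>R \<xi>)) \<longlonglongrightarrow> norm (c *\<^sub>R \<xi>) powr \<alpha>"
      unfolding \<Phi>_def by (intro AE_I2 lim)
    show "AE \<xi> in ?\<gamma>. norm (\<Phi> n (c *\<^sub>R \<xi>)) \<le> B * (1 + c\<^sup>2 * (norm \<xi>)\<^sup>2)" for n
      using B[of n "c *\<^sub>R \<xi>" for \<xi>] \<Phi>_nonneg by (auto simp: power_mult_distrib)
  qed (use meas in auto)
  have eq: "(LINT \<xi>|?\<gamma>. \<Phi> n (c *\<^sub>R \<xi>)) = (1 - (LINT y|\<mu> n. exp (- \<kappa> * (norm y)\<^sup>2))) / s n" for n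
  proof -
    have "integrable ?\<gamma> (\<lambda>\<xi>. LINT y|\<mu> n. cos ((c *\<^sub>R \<xi>) \<bullet> y))"
    proof -
      interpret prob_space "\<mu> n" by (rule prob)
      have [measurable]: "(\<lambda>\<xi>. LINT y|\<mu> n. cos (\<xi> \<bullet> y)) \<in> borel_measurable borel"
        by (intro borel_measurable_continuous_onI continuous_on_integral_cos prob sets)
      have "\<bar>LINT y|\<mu> n. cos ((c *\<^sub>R \<xi>) \<bullet> y)\<bar> \<le> 1" for \<xi>
        by (rule order_trans[OF integral_abs_bound integral_le_const]) (use int_cos[of n "c *\<^sub>R \<xi>"] in auto)
      then show ?thesis
        by (intro G.integrable_const_bound[where B = 1]) auto
    qed
    then have "(LINT \<xi>|?\<gamma>. \<Phi> n (c *\<^sub>R \<xi>)) = (1 - (LINT \<xi>|?\<gamma>. LINT y|\<mu> n. cos ((c *\<^sub>R \<xi>) \<bullet> y))) / s n"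
      unfolding \<Phi>_def using G.prob_space by (simp add: diff_divide_distrib)
    then show ?thesis
      using \<kappa> unfolding integral_gaussian_eq_integral_cos[OF prob sets, symmetric]
      by (simp add: c_def power_mult_distrib)
  qed
  have "(LINT \<xi>|?\<gamma>. norm (c *\<^sub>R \<xi>) powr \<alpha>) = c powr \<alpha> * (LINT \<xi>|?\<gamma>. norm \<xi> powr \<alpha>)"
    using \<kappa> by (simp add: powr_mult c_def)
  also have "(LINT \<xi>|?\<gamma>. norm \<xi> powr \<alpha>) = 2 powr (\<alpha> / 2) * Gamma ((?d + \<alpha>) / 2) / Gamma (?d / 2)"
    using std_gaussian_norm_powr[where 'a='a, of \<alpha>] \<alpha> by (simp add: has_bochner_integral_iff)
  also have "c powr \<alpha> = 2 powr (\<alpha> / 2) * \<kappa> powr (\<alpha> / 2)"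
    using \<kappa> by (simp add: c_def powr_half_sqrt[symmetric] powr_powr powr_mult)
  finally have val: "(LINT \<xi>|?\<gamma>. norm (c *\<^sub>R \<xi>) powr \<alpha>)
      = (2 powr (\<alpha> / 2) * 2 powr (\<alpha> / 2)) * Gamma ((?d + \<alpha>) / 2) / Gamma (?d / 2) * \<kappa> powr (\<alpha> / 2)"
    by (simp add: mult_ac)
  have "2 powr (\<alpha> / 2) * 2 powr (\<alpha> / 2) = 2 powr \<alpha>"
    by (simp flip: powr_add)
  with lim_int val eq show ?thesis by simp
qed

section \<open>From moments to continuous functions\<close>

text \<open>
  Convergence of the moments gives convergence for polynomials in \<open>v\<close>. The zeroth moment bounds
  the total masses, so that uniform approximation of \<open>g\<close> on the unit interval carries over.
\<close>

lemma tendsto_integral_of_moments: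
  fixes N :: "nat \<Rightarrow> 'b measure" and v :: "'b \<Rightarrow> real" and g :: "real \<Rightarrow> real"
  assumes fin: "\<And>n. finite_measure (N n)" "finite_measure L"
    and v: "\<And>n. v \<in> borel_measurable (N n)" "v \<in> borel_measurable L" "\<And>x. v x \<in> {0..1}"
    and mom: "\<And>k::nat. (\<lambda>n. LINT x|N n. v x ^ k) \<longlonglongrightarrow> (LINT x|L. v x ^ k)"
    and g: "continuous_on UNIV g"
  shows "(\<lambda>n. LINT x|N n. g (v x)) \<longlonglongrightarrow> (LINT x|L. g (v x))"
proof (rule LIMSEQ_I)
  fix \<epsilon> :: real assume "0 < \<epsilon>"
  define m where "m = measure L (space L)"
  have "0 \<le> m" by (simp add: m_def)
  define e where "e = \<epsilon> / (3 * (m + 1))"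
  have "0 < e" using \<open>0 < \<epsilon>\<close> \<open>0 \<le> m\<close> by (simp add: e_def)
  have [measurable]: "g \<in> borel_measurable borel"
    using g by (rule borel_measurable_continuous_onI)
  obtain P where P: "real_polynomial_function P" "\<And>x. x \<in> {0..1} \<Longrightarrow> \<bar>g x - P x\<bar> < e"
    using Stone_Weierstrass_real_polynomial_function[of "{0..1}" g e] \<open>0 < e\<close> continuous_on_subset[OF g] by auto
  then obtain a K where P_eq: "P = (\<lambda>x. \<Sum>i\<le>(K::nat). a i * x ^ i)"
    by (auto simp: real_polynomial_function_iff_sum)
  have [measurable]: "P \<in> borel_measurable borel" by (simp add: P_eq)
  have pow_int: "integrable M (\<lambda>x. v x ^ k)" and g_int: "integrable M (\<lambda>x. g (v x))"
    if M: "finite_measure M" "v \<in> borel_measurable M" for M k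
  proof -
    interpret finite_measure M by fact
    note [measurable] = M(2)
    show "integrable M (\<lambda>x. v x ^ k)"
      using v(3) by (intro integrable_const_bound[where B = 1]) (auto simp: power_le_one)
    obtain b where "\<And>x. x \<in> {0..1} \<Longrightarrow> \<bar>g x\<bar> \<le> b"
      using compact_imp_bounded[OF compact_continuous_image[OF continuous_on_subset[OF g subset_UNIV] compact_Icc[of 0 1]]]
      unfolding bounded_iff by (metis image_eqI real_norm_def)
    then show "integrable M (\<lambda>x. g (v x))"
      using v(3) by (intro integrable_const_bound[where B = b]) auto
  qed
  have err: "\<bar>(LINT x|M. g (v x)) - (\<Sum>i\<le>K. a i * (LINT x|M. v x ^ i))\<bar> \<le> e * measure M (space M)"
    if M: "finite_measure M" "v \<in> borel_measurable M" for M
  proof -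
    interpret finite_measure M by fact
    note [measurable] = M(2)
    note int = pow_int[OF M] g_int[OF M]
    have "(LINT x|M. g (v x)) - (\<Sum>i\<le>K. a i * (LINT x|M. v x ^ i)) = (LINT x|M. g (v x) - P (v x))"
      using int by (simp add: P_eq)
    also have "\<bar>\<dots>\<bar> \<le> (LINT x|M. \<bar>g (v x) - P (v x)\<bar>)"
      by (rule integral_abs_bound)
    also have "\<dots> \<le> (LINT x|M. e)"
      using int P(2) v(3) by (intro integral_mono) (auto simp: P_eq intro: less_imp_le)
    finally show ?thesis by (simp add: mult.commute)
  qed
  have "(\<lambda>n. \<Sum>i\<le>K. a i * (LINT x|N n. v x ^ i)) \<longlonglongrightarrow> (\<Sum>i\<le>K. a i * (LINT x|L. v x ^ i))"
    by (intro tendsto_intros mom)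
  then have ev1: "\<forall>\<^sub>F n in sequentially. \<bar>(\<Sum>i\<le>K. a i * (LINT x|N n. v x ^ i)) - (\<Sum>i\<le>K. a i * (LINT x|L. v x ^ i))\<bar> < e"
    using \<open>0 < e\<close> by (simp add: tendsto_iff dist_real_def)
  have "(\<lambda>n. measure (N n) (space (N n))) \<longlonglongrightarrow> m"
    using mom[of 0] fin by (simp add: m_def)
  then have ev2: "\<forall>\<^sub>F n in sequentially. measure (N n) (space (N n)) < m + 1"
    by (rule order_tendstoD) simp
  have "\<forall>\<^sub>F n in sequentially. norm ((LINT x|N n. g (v x)) - (LINT x|L. g (v x))) < \<epsilon>"
    using ev1 ev2
  proof eventually_elim
    case (elim n)
    have "\<bar>(LINT x|N n. g (v x)) - (LINT x|L. g (v x))\<bar> < e * measure (N n) (space (N n)) + e + e * m"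
      using err[OF fin(1) v(1), of n] err[OF fin(2) v(2)] elim(1) by (simp add: m_def)
    also have "\<dots> \<le> e * (m + 1) + e * (m + 1) + e * (m + 1)"
      using \<open>0 < e\<close> \<open>0 \<le> m\<close> elim(2) by (intro add_mono mult_left_mono) auto
    also have "e * (m + 1) = \<epsilon> / 3"
      using \<open>0 \<le> m\<close> unfolding e_def by (simp add: divide_simps)
    finally show ?case by simp
  qed
  then show "\<exists>no. \<forall>n\<ge>no. norm ((LINT x|N n. g (v x)) - (LINT x|L. g (v x))) < \<epsilon>"
    by (simp add: eventually_sequentially)
qed

section \<open>The stable Levy measure\<close>

lemma Gamma_reflection_real:
  "sin (pi * x) * Gamma x * Gamma (1 - x) = pi" if "0 < x" "x < 1" for x :: real
proof -
  have "complex_of_real (Gamma x * Gamma (1 - x)) = complex_of_real (pi / sin (pi * x))"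
    using Gamma_reflection_complex[of "complex_of_real x"]
    by (simp add: Gamma_complex_of_real[symmetric] sin_of_real[symmetric] del: sin_of_real)
  then have "Gamma x * Gamma (1 - x) = pi / sin (pi * x)"
    by (simp only: of_real_eq_iff)
  moreover have "0 < sin (pi * x)"
    using that by (intro sin_gt_zero) auto
  ultimately show ?thesis by (simp add: field_simps)
qed

text \<open>
  The left-hand side is the coefficient of the Laplace transform of the measure with density
  \<open>limit_constant * |y| powr (-d-\<alpha>)\<close>, the right-hand side that of the limit found by Gaussian
  averaging. They agree by the reflection formula at \<open>\<alpha>/2\<close>.
\<close>

lemma limit_constant_eq:
  assumes "0 < \<alpha>" "\<alpha> < 2" "0 < d"
  shows "limit_constant d \<alpha> * (pi powr (d / 2) * Gamma (1 - \<alpha> / 2) / Gamma (d / 2)) / (\<alpha> / 2)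
     = 2 powr \<alpha> * Gamma ((d + \<alpha>) / 2) / Gamma (d / 2)"
proof -
  have "limit_constant d \<alpha> * (pi powr (d / 2) * Gamma (1 - \<alpha> / 2) / Gamma (d / 2)) / (\<alpha> / 2)
     = (2 * 2 powr (\<alpha> - 1)) * (pi powr (- real d / 2 - 1) * pi powr (real d / 2)) *
        (sin (pi * (\<alpha> / 2)) * Gamma (\<alpha> / 2) * Gamma (1 - \<alpha> / 2)) * Gamma ((d + \<alpha>) / 2) / Gamma (d / 2)"
    using assms by (simp add: limit_constant_def mult_ac)
  also have "2 * 2 powr (\<alpha> - 1) = 2 powr \<alpha>"
    by (simp add: powr_diff)
  also have "pi powr (- real d / 2 - 1) * pi powr (real d / 2) = 1 / pi"
    by (simp add: powr_minus_divide flip: powr_add)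
  also have "sin (pi * (\<alpha> / 2)) * Gamma (\<alpha> / 2) * Gamma (1 - \<alpha> / 2) = pi"
    using assms by (intro Gamma_reflection_real) auto
  finally show ?thesis by simp
qed

text \<open>
  Write \<open>1 - exp (-\<kappa> |y|\<^sup>2)\<close> as the integral of \<open>|y|\<^sup>2 exp (-c |y|\<^sup>2)\<close> over \<open>c\<close> in \<open>[0, \<kappa>]\<close> and exchange
  the integrals. The factor \<open>|y|\<^sup>2\<close> makes the singularity at 0 integrable, as \<open>\<alpha> < 2\<close>, and the inner
  integral is a Gaussian moment proportional to \<open>c powr (\<alpha>/2 - 1)\<close>.
\<close>

lemma laplace_transform_stable_levy_measure:
  assumes \<alpha>: "0 < \<alpha>" "\<alpha> < 2" and \<kappa>: "0 \<le> \<kappa>"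
  shows "has_bochner_integral lborel
     (\<lambda>y::'a::euclidean_space. norm y powr (- real DIM('a) - \<alpha>) * (1 - exp (- \<kappa> * (norm y)\<^sup>2)))
     (pi powr (DIM('a) / 2) * Gamma (1 - \<alpha> / 2) / Gamma (DIM('a) / 2) * (\<kappa> powr (\<alpha> / 2) / (\<alpha> / 2)))"
proof (rule has_bochner_integral_nn_integral)
  let ?d = "real DIM('a)"
  define K where "K = pi powr (?d / 2) * Gamma (1 - \<alpha> / 2) / Gamma (?d / 2)"
  have "0 < Gamma (1 - \<alpha> / 2)" "0 < Gamma (?d / 2)"
    using \<alpha> by (auto intro!: Gamma_real_pos)
  then have "0 \<le> K" by (simp add: K_def)
  then show "0 \<le> K * (\<kappa> powr (\<alpha> / 2) / (\<alpha> / 2))" using \<alpha> by simp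
  show "AE y::'a in lborel. 0 \<le> norm y powr (- ?d - \<alpha>) * (1 - exp (- \<kappa> * (norm y)\<^sup>2))"
    using \<kappa> by (intro AE_I2 mult_nonneg_nonneg) auto
  have inner: "(\<integral>\<^sup>+c. ennreal (norm y powr (2 - ?d - \<alpha>) * exp (- c * (norm y)\<^sup>2)) * indicator {0..\<kappa>} c \<partial>lborel)
      = ennreal (norm y powr (- ?d - \<alpha>) * (1 - exp (- \<kappa> * (norm y)\<^sup>2)))" (is "?l = ?r") for y :: 'a
  proof (cases "y = 0")
    case False
    have p: "norm y powr (2 - ?d - \<alpha>) = norm y powr (- ?d - \<alpha>) * (norm y)\<^sup>2"
    proof -
      have "2 - ?d - \<alpha> = (- ?d - \<alpha>) + 2" by simp
      then show ?thesis
        using False by (simp only: powr_add) simp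
    qed
    have "?l = ennreal (- (norm y powr (- ?d - \<alpha>)) * exp (- \<kappa> * (norm y)\<^sup>2) - (- (norm y powr (- ?d - \<alpha>)) * exp (- 0 * (norm y)\<^sup>2)))"
      using \<kappa> unfolding p
      by (intro nn_integral_FTC_Icc) (auto intro!: derivative_eq_intros)
    then show ?thesis by (simp add: algebra_simps)
  qed simp
  have "(\<integral>\<^sup>+y. ennreal (norm (y::'a) powr (- ?d - \<alpha>) * (1 - exp (- \<kappa> * (norm y)\<^sup>2))) \<partial>lborel)
     = (\<integral>\<^sup>+y. (\<integral>\<^sup>+c. ennreal (norm (y::'a) powr (2 - ?d - \<alpha>) * exp (- c * (norm y)\<^sup>2)) * indicator {0..\<kappa>} c \<partial>lborel) \<partial>lborel)"
    by (simp only: inner)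
  also have "\<dots> = (\<integral>\<^sup>+c. (\<integral>\<^sup>+y. ennreal (norm (y::'a) powr (2 - ?d - \<alpha>) * exp (- c * (norm y)\<^sup>2)) * indicator {0..\<kappa>} c \<partial>lborel) \<partial>lborel)"
    by (rule lborel_pair.Fubini') measurable
  also have "\<dots> = (\<integral>\<^sup>+c. ennreal K * ennreal (indicator {0..\<kappa>} c * c powr (\<alpha> / 2 - 1)) \<partial>lborel)"
  proof (rule nn_integral_cong_AE, rule AE_mp[OF AE_lborel_singleton[of 0]], rule AE_I2, rule impI)
    fix c :: real assume "c \<noteq> 0"
    show "(\<integral>\<^sup>+y. ennreal (norm (y::'a) powr (2 - ?d - \<alpha>) * exp (- c * (norm y)\<^sup>2)) * indicator {0..\<kappa>} c \<partial>lborel)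
       = ennreal K * ennreal (indicator {0..\<kappa>} c * c powr (\<alpha> / 2 - 1))"
    proof (cases "c \<in> {0..\<kappa>}")
      case True
      with \<open>c \<noteq> 0\<close> have "0 < c" by simp
      then have "(\<integral>\<^sup>+y. ennreal (norm (y::'a) powr (2 - ?d - \<alpha>) * exp (- c * (norm y)\<^sup>2)) \<partial>lborel)
          = ennreal (K * c powr (- (?d + (2 - ?d - \<alpha>)) / 2))"
        using \<alpha> by (subst nn_integral_gaussian_moment) (auto simp: K_def diff_divide_distrib)
      also have "- (?d + (2 - ?d - \<alpha>)) / 2 = \<alpha> / 2 - 1" by (simp add: field_simps)
      finally show ?thesis using True \<open>0 \<le> K\<close> by (simp add: ennreal_mult')
    qed simp
  qed
  also have "\<dots> = ennreal K * (\<integral>\<^sup>+c. ennreal (indicator {0..\<kappa>} c * c powr (\<alpha> / 2 - 1)) \<partial>lborel)"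
    by (rule nn_integral_cmult) simp
  also have "(\<integral>\<^sup>+c. ennreal (indicator {0..\<kappa>} c * c powr (\<alpha> / 2 - 1)) \<partial>lborel) = ennreal (\<kappa> powr (\<alpha> / 2 - 1 + 1) / (\<alpha> / 2 - 1 + 1))"
    by (rule nn_integral_has_integral_lebesgue[OF _ has_integral_powr_from_0]) (use \<alpha> \<kappa> in auto)
  finally show "(\<integral>\<^sup>+y. ennreal (norm (y::'a) powr (- ?d - \<alpha>) * (1 - exp (- \<kappa> * (norm y)\<^sup>2))) \<partial>lborel)
     = ennreal (K * (\<kappa> powr (\<alpha> / 2) / (\<alpha> / 2)))"
    unfolding ennreal_mult'[OF \<open>0 \<le> K\<close>] by simp
qed measurable

section \<open>From measures to unimodal densities\<close>

text \<open>
  Outside the ball through \<open>e\<close> the density is at most \<open>f e\<close>; the next lemma is the counterpart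
  inside the ball.
\<close>

lemma isotropic_unimodal_density_nn_integral_le:
  fixes \<mu> :: "'a::euclidean_space measure"
  assumes f: "isotropic_unimodal_density \<mu> f" and sets[measurable_cong]: "sets \<mu> = sets borel"
    and e: "e \<noteq> 0" and S[measurable]: "S \<in> sets borel" and le: "\<And>y. y \<in> S \<Longrightarrow> norm e \<le> norm y"
    and [measurable]: "G \<in> borel_measurable borel"
  shows "(\<integral>\<^sup>+y\<in>S. G y \<partial>\<mu>) \<le> ennreal (f e) * (\<integral>\<^sup>+y\<in>S. G y \<partial>lborel)"
proof -
  let ?N = "density lborel (\<lambda>y. ennreal (f e) * indicator S y)"
  have "0 \<notin> S" using le[of 0] e by auto
  have "emeasure (density \<mu> (indicator S)) A \<le> emeasure ?N A" if [measurable]: "A \<in> sets borel" for A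
  proof -
    have "emeasure (density \<mu> (indicator S)) A = emeasure \<mu> (S \<inter> A)"
      by (subst emeasure_density) (auto simp: sets simp flip: indicator_inter_arith)
    also have "\<dots> = (\<integral>\<^sup>+y. ennreal (f y) * indicator (S \<inter> A) y \<partial>lborel)"
      using f \<open>0 \<notin> S\<close> by (simp add: isotropic_unimodal_density_def)
    also have "\<dots> \<le> (\<integral>\<^sup>+y. ennreal (f e) * indicator (S \<inter> A) y \<partial>lborel)"
      using f e le by (intro nn_integral_mono) (auto simp: isotropic_unimodal_density_def indicator_def intro!: ennreal_leI)
    also have "\<dots> = emeasure ?N A"
      by (simp add: emeasure_density indicator_inter_arith mult.assoc)
    finally show ?thesis .
  qed
  then have "density \<mu> (indicator S) \<le> ?N"
    by (subst le_measure) (simp_all add: sets)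
  then have "(\<integral>\<^sup>+y. G y \<partial>density \<mu> (indicator S)) \<le> (\<integral>\<^sup>+y. G y \<partial>?N)"
    by (intro nn_integral_mono_measure) (simp_all add: sets)
  then show ?thesis
    by (simp add: nn_integral_density nn_integral_cmult[symmetric] mult_ac)
qed

lemma isotropic_unimodal_density_nn_integral_ge:
  fixes \<mu> :: "'a::euclidean_space measure"
  assumes f: "isotropic_unimodal_density \<mu> f" and sets[measurable_cong]: "sets \<mu> = sets borel"
    and S[measurable]: "S \<in> sets borel" "0 \<notin> S" and le: "\<And>y. y \<in> S \<Longrightarrow> norm y \<le> norm e"
    and [measurable]: "G \<in> borel_measurable borel"
  shows "ennreal (f e) * (\<integral>\<^sup>+y\<in>S. G y \<partial>lborel) \<le> (\<integral>\<^sup>+y\<in>S. G y \<partial>\<mu>)"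
proof -
  let ?N = "density lborel (\<lambda>y. ennreal (f e) * indicator S y)"
  have "emeasure ?N A \<le> emeasure (density \<mu> (indicator S)) A" if [measurable]: "A \<in> sets borel" for A
  proof -
    have "emeasure ?N A = (\<integral>\<^sup>+y. ennreal (f e) * indicator (S \<inter> A) y \<partial>lborel)"
      by (simp add: emeasure_density indicator_inter_arith mult.assoc)
    also have "\<dots> \<le> (\<integral>\<^sup>+y. ennreal (f y) * indicator (S \<inter> A) y \<partial>lborel)"
    proof (intro nn_integral_mono)
      fix y
      have "f e \<le> f y" if "y \<in> S"
      proof -
        have "y \<noteq> 0" using that S(2) by auto
        then show ?thesis
          using f le[OF that] by (auto simp: isotropic_unimodal_density_def)
      qed
      then show "ennreal (f e) * indicator (S \<inter> A) y \<le> ennreal (f y) * indicator (S \<inter> A) y"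
        by (auto simp: indicator_def intro!: ennreal_leI)
    qed
    also have "\<dots> = emeasure \<mu> (S \<inter> A)"
      using f S(2) by (simp add: isotropic_unimodal_density_def)
    also have "\<dots> = emeasure (density \<mu> (indicator S)) A"
      by (subst emeasure_density) (auto simp: sets simp flip: indicator_inter_arith)
    finally show ?thesis .
  qed
  then have "?N \<le> density \<mu> (indicator S)"
    by (subst le_measure) (simp_all add: sets)
  then have "(\<integral>\<^sup>+y. G y \<partial>?N) \<le> (\<integral>\<^sup>+y. G y \<partial>density \<mu> (indicator S))"
    by (intro nn_integral_mono_measure) (simp_all add: sets)
  then show ?thesis
    by (simp add: nn_integral_density nn_integral_cmult[symmetric] mult_ac)
qed

text \<open>
  The core of the argument. In the proof \<open>v = exp (-|y|\<^sup>2)\<close>, \<open>N n\<close> is the finite measure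
  \<open>(1 - v) \<mu> n / s n\<close>, and \<open>L\<close> is its expected limit, with density \<open>W\<close>. The factor \<open>1 - v\<close>
  removes the singularity at 0: it makes \<open>L\<close> finite and removes a possible atom of \<open>\<mu> n\<close> there.
\<close>

lemma tendsto_unimodal_density:
  fixes \<mu> :: "nat \<Rightarrow> 'a::euclidean_space measure" and s :: "nat \<Rightarrow> real" and \<alpha> :: real
  assumes prob: "\<And>n. prob_space (\<mu> n)" and sets: "\<And>n. sets (\<mu> n) = sets borel"
    and q: "\<And>n. isotropic_unimodal_density (\<mu> n) (q n)"
    and s: "\<And>n. 0 < s n" and \<alpha>: "0 < \<alpha>" "\<alpha> < 2"
    and lim: "\<And>\<xi>. (\<lambda>n. (1 - (LINT y|\<mu> n. cos (\<xi> \<bullet> y))) / s n) \<longlonglongrightarrow> norm \<xi> powr \<alpha>"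
    and e: "norm e = 1"
  shows "(\<lambda>n. q n e / s n) \<longlonglongrightarrow> limit_constant DIM('a) \<alpha>"
proof -
  note [measurable_cong] = sets
  let ?d = "real DIM('a)"
  define A where "A = limit_constant DIM('a) \<alpha>"
  define v where "v y = exp (- (norm y)\<^sup>2)" for y :: 'a
  have v01: "v y \<in> {0..1}" for y by (simp add: v_def)
  have [measurable]: "v \<in> borel_measurable borel" by (simp add: v_def[abs_def])
  have cont_v: "continuous_on T v" for T unfolding v_def[abs_def] by (intro continuous_intros)
  have v_pow: "v y ^ k = exp (- real k * (norm y)\<^sup>2)" for y k
    by (simp add: v_def exp_of_nat_mult[symmetric])
  have "0 < sin (\<alpha> * pi / 2)"
    using \<alpha> by (intro sin_gt_zero) auto
  then have "0 < A"
    using \<alpha> by (auto simp: A_def limit_constant_def intro!: mult_pos_pos Gamma_real_pos add_pos_pos)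
  define N where "N n = density (\<mu> n) (\<lambda>y. ennreal ((1 - v y) / s n))" for n
  define W where "W y = A * norm y powr (- ?d - \<alpha>) * (1 - v y)" for y :: 'a
  have [measurable]: "W \<in> borel_measurable borel" by (simp add: W_def[abs_def])
  have W_nonneg: "0 \<le> W y" for y using \<open>0 < A\<close> v01[of y] by (simp add: W_def)
  define L where "L = density lborel (\<lambda>y. ennreal (W y))"
  define C where "C = 2 powr \<alpha> * Gamma ((?d + \<alpha>) / 2) / Gamma (?d / 2)"
  have limit_moment: "has_bochner_integral lborel (\<lambda>y::'a. A * norm y powr (- ?d - \<alpha>) * (1 - v y ^ k)) (C * real k powr (\<alpha> / 2))" for k
  proof -
    have "A * (pi powr (?d / 2) * Gamma (1 - \<alpha> / 2) / Gamma (?d / 2) * (real k powr (\<alpha> / 2) / (\<alpha> / 2))) = C * real k powr (\<alpha> / 2)"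
    proof -
      have "A * (pi powr (?d / 2) * Gamma (1 - \<alpha> / 2) / Gamma (?d / 2) * (real k powr (\<alpha> / 2) / (\<alpha> / 2)))
          = A * (pi powr (?d / 2) * Gamma (1 - \<alpha> / 2) / Gamma (?d / 2)) / (\<alpha> / 2) * real k powr (\<alpha> / 2)"
        by simp
      then show ?thesis
        by (simp only: limit_constant_eq[OF \<alpha> DIM_positive[where 'a='a]] A_def C_def)
    qed
    then show ?thesis
      using has_bochner_integral_mult_right[OF laplace_transform_stable_levy_measure[OF \<alpha>, of "real k", where 'a='a], of A]
      by (simp only: v_pow of_nat_0_le_iff mult.assoc simp_thms)
  qed
  have conv: "(\<lambda>n. (LINT y|\<mu> n. (1 - v y) * g (v y)) / s n) \<longlonglongrightarrow> (LINT y|lborel. W y * g (v y))"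
    if g: "continuous_on UNIV g" for g :: "real \<Rightarrow> real"
  proof -
    have [measurable]: "g \<in> borel_measurable borel"
      using g by (rule borel_measurable_continuous_onI)
    have N_int: "(LINT y|N n. f (v y)) = (LINT y|\<mu> n. (1 - v y) * f (v y)) / s n"
      if [measurable]: "f \<in> borel_measurable borel" for n and f :: "real \<Rightarrow> real"
      unfolding N_def using v01 s[of n] by (subst integral_density) (auto intro!: divide_nonneg_pos)
    have L_int: "(LINT y|L. f (v y)) = (LINT y|lborel. W y * f (v y))"
      if [measurable]: "f \<in> borel_measurable borel" for f :: "real \<Rightarrow> real"
      unfolding L_def using W_nonneg by (subst integral_density) auto
    have "(\<lambda>n. LINT y|N n. g (v y)) \<longlonglongrightarrow> (LINT y|L. g (v y))"
    proof (rule tendsto_integral_of_moments[OF _ _ _ _ v01 _ g])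
      show "v \<in> borel_measurable (N n)" "v \<in> borel_measurable L" for n
        by (simp_all add: N_def L_def)
      show "finite_measure (N n)" for n
      proof
        interpret prob_space "\<mu> n" by (rule prob)
        have "emeasure (N n) (space (N n)) = (\<integral>\<^sup>+y. ennreal ((1 - v y) / s n) \<partial>\<mu> n)"
          by (simp add: N_def emeasure_density cong: nn_integral_cong_simp)
        also have "\<dots> \<le> (\<integral>\<^sup>+y. ennreal (1 / s n) \<partial>\<mu> n)"
          using v01 s[of n] by (intro nn_integral_mono ennreal_leI divide_right_mono) auto
        finally show "emeasure (N n) (space (N n)) \<noteq> \<infinity>"
          by (auto simp: emeasure_space_1 top_unique)
      qed
      show "finite_measure L"
      proof
        have "integrable lborel W"
          using limit_moment[of 1] by (simp add: has_bochner_integral_iff W_def[abs_def])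
        then show "emeasure L (space L) \<noteq> \<infinity>"
          using W_nonneg by (simp add: L_def emeasure_density nn_integral_eq_integral)
      qed
      \<comment> \<open>\<open>(1 - v) * v ^ k = (1 - v ^ Suc k) - (1 - v ^ k)\<close>, so the moments are differences of Laplace transforms\<close>
      show "(\<lambda>n. LINT y|N n. v y ^ k) \<longlonglongrightarrow> (LINT y|L. v y ^ k)" for k
      proof -
        have "(\<lambda>n. (1 - (LINT y|\<mu> n. v y ^ Suc k)) / s n - (1 - (LINT y|\<mu> n. v y ^ k)) / s n) \<longlonglongrightarrow>
              C * real (Suc k) powr (\<alpha> / 2) - C * real k powr (\<alpha> / 2)"
          unfolding v_pow C_def
          by (intro tendsto_diff tendsto_laplace_transform prob sets s \<alpha> lim) auto
        moreover have "(1 - (LINT y|\<mu> n. v y ^ Suc k)) / s n - (1 - (LINT y|\<mu> n. v y ^ k)) / s n = (LINT y|N n. v y ^ k)" for n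
        proof -
          interpret prob_space "\<mu> n" by (rule prob)
          have "integrable (\<mu> n) (\<lambda>y. v y ^ k)" for k
            using v01 by (intro integrable_const_bound[where B = 1]) (auto simp: power_le_one)
          from Bochner_Integration.integral_diff[OF this[of k] this[of "Suc k"]]
          have "(LINT y|\<mu> n. v y ^ k) - (LINT y|\<mu> n. v y ^ Suc k) = (LINT y|\<mu> n. (1 - v y) * v y ^ k)"
            by (simp add: algebra_simps)
          then show ?thesis
            by (simp add: N_int[of "\<lambda>z. z ^ k"] diff_divide_distrib[symmetric])
        qed
        moreover have "C * real (Suc k) powr (\<alpha> / 2) - C * real k powr (\<alpha> / 2) = (LINT y|L. v y ^ k)"
        proof -
          have "(LINT y|L. v y ^ k) = (LINT y|lborel. A * norm y powr (- ?d - \<alpha>) * (1 - v y ^ Suc k) - A * norm y powr (- ?d - \<alpha>) * (1 - v y ^ k))"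
            unfolding L_int[of "\<lambda>z. z ^ k", simplified]
            by (intro Bochner_Integration.integral_cong) (auto simp: W_def algebra_simps)
          also have "\<dots> = C * real (Suc k) powr (\<alpha> / 2) - C * real k powr (\<alpha> / 2)"
            using has_bochner_integral_diff[OF limit_moment[of "Suc k"] limit_moment[of k]]
            by (simp only: has_bochner_integral_iff)
          finally show ?thesis by simp
        qed
        ultimately show ?thesis by simp
      qed
    qed
    then show ?thesis by (simp add: N_int L_int)
  qed
  \<comment> \<open>\<open>g a b (v y)\<close> is a bump that is positive exactly on the shell \<open>a < |y|\<^sup>2 < b\<close>, when \<open>a < b\<close>\<close>
  define g where "g a b z = max 0 ((z - exp (- b)) * (exp (- a) - z))" for a b z :: real
  define h where "h a b y = (1 - v y) * g a b (v y)" for a b and y :: 'a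
  define I where "I a b = (LINT y|lborel. h a b y)" for a b
  have cont_g: "continuous_on T (g a b)" for a b T
    unfolding g_def[abs_def] by (intro continuous_intros)
  have cont_h: "continuous_on T (h a b)" for a b T
    unfolding h_def[abs_def]
    by (intro continuous_intros cont_v continuous_on_compose2[OF cont_g[of UNIV]]) auto
  have h_meas[measurable]: "h a b \<in> borel_measurable borel" for a b
    by (intro borel_measurable_continuous_onI cont_h)
  have h_nonneg: "0 \<le> h a b y" for a b y
    using v01[of y] by (simp add: h_def g_def)
  have g_zero: "g a b z = 0" if "a < b" "z \<le> exp (- b) \<or> exp (- a) \<le> z" for a b z
  proof -
    have "exp (- b) < exp (- a)" using that(1) by simp
    have "(z - exp (- b)) * (exp (- a) - z) \<le> 0"
      using that(2)
    proof
      assume "z \<le> exp (- b)"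
      with \<open>exp (- b) < exp (- a)\<close> show ?thesis by (intro mult_nonpos_nonneg) linarith+
    next
      assume "exp (- a) \<le> z"
      with \<open>exp (- b) < exp (- a)\<close> show ?thesis by (intro mult_nonneg_nonpos) linarith+
    qed
    then show ?thesis by (simp add: g_def)
  qed
  have h_supp: "a < (norm y)\<^sup>2 \<and> (norm y)\<^sup>2 < b" if "a < b" "h a b y \<noteq> 0" for a b y
    using that g_zero[of a b "v y"] by (force simp: h_def v_def)
  have h_pos: "0 < h a b y" if "0 < a" "a < (norm y)\<^sup>2" "(norm y)\<^sup>2 < b" for a b y
    using that by (auto simp: h_def g_def v_def less_max_iff_disj intro!: mult_pos_pos)
  have h_int: "integrable lborel (h a b)" if "a < b" for a b
  proof -
    have "integrable lborel (\<lambda>y. indicator (cball 0 (sqrt b)) y *\<^sub>R h a b y)"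
      by (rule borel_integrable_compact) (auto intro: cont_h)
    also have "(\<lambda>y. indicator (cball 0 (sqrt b)) y *\<^sub>R h a b y) = h a b"
    proof
      fix y
      have "norm y \<le> sqrt b" if "h a b y \<noteq> 0"
        using h_supp[OF \<open>a < b\<close> that] by (intro real_le_rsqrt) simp
      then show "indicator (cball 0 (sqrt b)) y *\<^sub>R h a b y = h a b y"
        by (auto simp: indicator_def)
    qed
    finally show ?thesis .
  qed
  have I_pos: "0 < I a b" if "0 < a" "a < b" for a b
  proof (rule ccontr)
    assume "\<not> 0 < I a b"
    then have "I a b = 0"
      using Bochner_Integration.integral_nonneg[of lborel "h a b", OF h_nonneg] by (simp add: I_def)
    then have "AE y in lborel. h a b y = 0"
      using h_int[OF that(2)] h_nonneg by (simp add: I_def integral_nonneg_eq_0_iff_AE)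
    moreover define U where "U = {y::'a. a < (norm y)\<^sup>2 \<and> (norm y)\<^sup>2 < b}"
    ultimately have "AE y in lborel. y \<notin> U"
      using h_pos[OF that(1)] by (elim eventually_mono) (metis (mono_tags, lifting) U_def less_irrefl mem_Collect_eq)
    moreover have "open U"
      unfolding U_def by (intro open_Collect_conj open_Collect_less continuous_intros)
    ultimately have "U \<in> null_sets lborel"
      by (simp add: AE_iff_null_sets[symmetric])
    then have "negligible U"
      by (simp add: negligible_iff_null_sets null_sets_completionI)
    moreover have "sqrt ((a + b) / 2) *\<^sub>R e \<in> U"
      using that e by (simp add: U_def)
    ultimately show False
      using open_not_negligible[OF \<open>open U\<close>] by auto
  qed
  have h_mu: "ennreal (LINT y|\<mu> n. h a b y) = (\<integral>\<^sup>+y\<in>{y. a \<le> (norm y)\<^sup>2 \<and> (norm y)\<^sup>2 \<le> b}. ennreal (h a b y) \<partial>\<mu> n)"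
    and h_leb: "ennreal (I a b) = (\<integral>\<^sup>+y\<in>{y. a \<le> (norm y)\<^sup>2 \<and> (norm y)\<^sup>2 \<le> b}. ennreal (h a b y) \<partial>lborel)"
    if "a < b" for a b n
  proof -
    have eq: "ennreal (h a b y) * indicator {y. a \<le> (norm y)\<^sup>2 \<and> (norm y)\<^sup>2 \<le> b} y = ennreal (h a b y)" for y
      using h_supp[OF that, of y] by (cases "h a b y = 0") (auto simp: indicator_def)
    interpret prob_space "\<mu> n" by (rule prob)
    obtain B where B: "\<And>z. z \<in> {0..1} \<Longrightarrow> \<bar>g a b z\<bar> \<le> B"
      using compact_imp_bounded[OF compact_continuous_image[OF cont_g compact_Icc[of 0 1]]]
      unfolding bounded_iff by (metis image_eqI real_norm_def)
    have "\<bar>h a b y\<bar> \<le> 1 * B" for y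
      unfolding h_def abs_mult using v01[of y] B[OF v01] by (intro mult_mono) auto
    then have "integrable (\<mu> n) (h a b)"
      by (intro integrable_const_bound[where B = B]) auto
    then show "ennreal (LINT y|\<mu> n. h a b y) = (\<integral>\<^sup>+y\<in>{y. a \<le> (norm y)\<^sup>2 \<and> (norm y)\<^sup>2 \<le> b}. ennreal (h a b y) \<partial>\<mu> n)"
      unfolding eq using h_nonneg by (simp add: nn_integral_eq_integral)
    show "ennreal (I a b) = (\<integral>\<^sup>+y\<in>{y. a \<le> (norm y)\<^sup>2 \<and> (norm y)\<^sup>2 \<le> b}. ennreal (h a b y) \<partial>lborel)"
      unfolding eq I_def using h_nonneg h_int[OF that] by (simp add: nn_integral_eq_integral)
  qed
  have lim_h: "(\<lambda>n. (LINT y|\<mu> n. h a b y) / s n) \<longlonglongrightarrow> (LINT y|lborel. A * norm y powr (- ?d - \<alpha>) * h a b y)" for a b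
    using conv[OF cont_g[of UNIV a b]] by (simp add: h_def W_def mult.assoc)
  have "e \<noteq> 0" using e by auto
  have q_nonneg: "0 \<le> q n e" for n
    using q[of n] \<open>e \<noteq> 0\<close> by (simp add: isotropic_unimodal_density_def)
  define p where "p = (?d + \<alpha>) / 2"
  have "0 < p" using \<alpha> by (simp add: p_def add_nonneg_pos)
  have powr_p: "norm y powr (- ?d - \<alpha>) = (norm y)\<^sup>2 powr - p" for y :: 'a
  proof -
    have "(norm y)\<^sup>2 powr - p = (norm y powr 2) powr - p" by simp
    also have "\<dots> = norm y powr (- ?d - \<alpha>)"
      unfolding powr_powr by (rule arg_cong[where f = "(powr) (norm y)"]) (simp add: p_def field_simps)
    finally show ?thesis by simp
  qed
  \<comment> \<open>the shell outside the unit sphere\<close>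
  have lower: "(LINT y|\<mu> n. h 1 b y) \<le> q n e * I 1 b" if "1 < b" for b n
  proof -
    have "ennreal (LINT y|\<mu> n. h 1 b y) \<le> ennreal (q n e) * ennreal (I 1 b)"
      unfolding h_mu[OF that] h_leb[OF that]
      by (rule isotropic_unimodal_density_nn_integral_le[OF q sets \<open>e \<noteq> 0\<close>])
         (auto simp: e abs_square_le_1 power2_nonneg_ge_1_iff)
    then show ?thesis
      using q_nonneg[of n] I_pos[of 1 b] that by (simp flip: ennreal_mult)
  qed
  \<comment> \<open>the shell inside the unit sphere\<close>
  have upper: "q n e * I a 1 \<le> (LINT y|\<mu> n. h a 1 y)" if "0 < a" "a < 1" for a n
  proof -
    have "ennreal (q n e) * ennreal (I a 1) \<le> ennreal (LINT y|\<mu> n. h a 1 y)"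
      unfolding h_mu[OF that(2)] h_leb[OF that(2)]
      by (rule isotropic_unimodal_density_nn_integral_ge[OF q sets])
         (use that in \<open>auto simp: e abs_square_le_1\<close>)
    then show ?thesis
      using q_nonneg[of n] I_pos[of a 1] that h_nonneg
      by (simp add: Bochner_Integration.integral_nonneg flip: ennreal_mult)
  qed
  have W_int: "integrable lborel (\<lambda>y. A * norm y powr (- ?d - \<alpha>) * h a b y)" if "0 < a" "a < b" for a b
  proof (rule Bochner_Integration.integrable_bound[OF integrable_mult_right[OF h_int[OF that(2)], of "A * a powr - p"]])
    show "AE y in lborel. norm (A * norm y powr (- ?d - \<alpha>) * h a b y) \<le> norm (A * a powr - p * h a b y)"
    proof (rule AE_I2)
      fix y
      have "(norm y)\<^sup>2 powr - p \<le> a powr - p" if "h a b y \<noteq> 0"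
        using h_supp[OF \<open>a < b\<close> that] \<open>0 < a\<close> \<open>0 < p\<close> by (intro powr_mono2') auto
      then show "norm (A * norm y powr (- ?d - \<alpha>) * h a b y) \<le> norm (A * a powr - p * h a b y)"
        unfolding powr_p using \<open>0 < A\<close> h_nonneg[of a b y]
        by (cases "h a b y = 0") (auto simp: abs_mult)
    qed
  qed simp
  \<comment> \<open>on a shell the limiting density is comparable with its value at the far boundary, which tends to \<open>A\<close> as the shell shrinks\<close>
  have W_lower: "A * b powr - p * I 1 b \<le> (LINT y|lborel. A * norm y powr (- ?d - \<alpha>) * h 1 b y)" if "1 < b" for b
  proof -
    have "A * b powr - p * h 1 b y \<le> A * norm y powr (- ?d - \<alpha>) * h 1 b y" for y
    proof (cases "h 1 b y = 0")
      case False
      then have "b powr - p \<le> (norm y)\<^sup>2 powr - p"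
        using h_supp[OF that False] \<open>0 < p\<close> by (intro powr_mono2') auto
      then show ?thesis
        unfolding powr_p using \<open>0 < A\<close> h_nonneg[of 1 b y] by (intro mult_right_mono mult_left_mono) auto
    qed simp
    then have "(LINT y|lborel. A * b powr - p * h 1 b y) \<le> (LINT y|lborel. A * norm y powr (- ?d - \<alpha>) * h 1 b y)"
      using that by (intro integral_mono integrable_mult_right h_int W_int) auto
    then show ?thesis by (simp add: I_def)
  qed
  have W_upper: "(LINT y|lborel. A * norm y powr (- ?d - \<alpha>) * h a 1 y) \<le> A * a powr - p * I a 1" if "0 < a" "a < 1" for a
  proof -
    have "A * norm y powr (- ?d - \<alpha>) * h a 1 y \<le> A * a powr - p * h a 1 y" for y
    proof (cases "h a 1 y = 0")
      case False
      then have "(norm y)\<^sup>2 powr - p \<le> a powr - p"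
        using h_supp[OF that(2) False] \<open>0 < p\<close> that(1) by (intro powr_mono2') auto
      then show ?thesis
        unfolding powr_p using \<open>0 < A\<close> h_nonneg[of a 1 y] by (intro mult_right_mono mult_left_mono) auto
    qed simp
    then have "(LINT y|lborel. A * norm y powr (- ?d - \<alpha>) * h a 1 y) \<le> (LINT y|lborel. A * a powr - p * h a 1 y)"
      using that by (intro integral_mono integrable_mult_right h_int W_int) auto
    then show ?thesis by (simp add: I_def)
  qed
  have at_1: "((\<lambda>z. A * z powr - p) \<longlongrightarrow> A) (at 1)"
  proof -
    have "((\<lambda>z. A * z powr - p) \<longlongrightarrow> A * 1 powr - p) (at 1)"
      by (intro tendsto_intros) auto
    then show ?thesis by simp
  qed
  have "(\<lambda>n. q n e / s n) \<longlonglongrightarrow> A"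
  proof (rule order_tendstoI)
    fix c assume "c < A"
    have "\<forall>\<^sub>F z in at_right 1. c < A * z powr - p \<and> 1 < z"
      using order_tendstoD(1)[OF at_1 \<open>c < A\<close>] eventually_at_right_less[of "1::real"]
      by (auto simp: eventually_at_split intro: eventually_conj)
    then obtain b where b: "c < A * b powr - p" "1 < b"
      using eventually_happens[of _ "at_right (1::real)"] by auto
    have "0 < I 1 b" using b I_pos by simp
    then have "c * I 1 b < A * b powr - p * I 1 b" using b by simp
    also note W_lower[OF b(2)]
    finally have "\<forall>\<^sub>F n in sequentially. c * I 1 b < (LINT y|\<mu> n. h 1 b y) / s n"
      by (rule order_tendstoD(1)[OF lim_h])
    then show "\<forall>\<^sub>F n in sequentially. c < q n e / s n"
    proof eventually_elim
      case (elim n)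
      also have "(LINT y|\<mu> n. h 1 b y) / s n \<le> q n e * I 1 b / s n"
        using lower[OF b(2), of n] s[of n] by (intro divide_right_mono) auto
      finally have "c * I 1 b < (q n e / s n) * I 1 b" by simp
      then show ?case using \<open>0 < I 1 b\<close> by (simp only: mult_less_cancel_right_pos)
    qed
  next
    fix c assume "A < c"
    have "\<forall>\<^sub>F z in at_left 1. A * z powr - p < c \<and> z \<in> {0<..<1}"
      using order_tendstoD(2)[OF at_1 \<open>A < c\<close>] eventually_at_left_real[of 0 "1::real"]
      by (auto simp: eventually_at_split intro: eventually_conj)
    then obtain a where a: "A * a powr - p < c" "0 < a" "a < 1"
      using eventually_happens[of _ "at_left (1::real)"] by auto
    have "0 < I a 1" using a I_pos by simp
    note W_upper[OF a(2,3)]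
    also have "A * a powr - p * I a 1 < c * I a 1" using a \<open>0 < I a 1\<close> by simp
    finally have "\<forall>\<^sub>F n in sequentially. (LINT y|\<mu> n. h a 1 y) / s n < c * I a 1"
      by (rule order_tendstoD(2)[OF lim_h])
    then show "\<forall>\<^sub>F n in sequentially. q n e / s n < c"
    proof eventually_elim
      case (elim n)
      have "q n e * I a 1 / s n \<le> (LINT y|\<mu> n. h a 1 y) / s n"
        using upper[OF a(2,3), of n] s[of n] by (intro divide_right_mono) auto
      also note elim
      finally have "(q n e / s n) * I a 1 < c * I a 1" by simp
      then show ?case using \<open>0 < I a 1\<close> by (simp only: mult_less_cancel_right_pos)
    qed
  qed
  then show ?thesis by (simp add: A_def)
qed

section \<open>Rescaling and radial exponents\<close>

text \<open>
  Away from 0 a unimodal density is a monotone function of the norm. Measurability is needed to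
  change variables under rescaling.
\<close>

lemma isotropic_unimodal_density_measurable:
  fixes \<mu> :: "'a::euclidean_space measure"
  assumes f: "isotropic_unimodal_density \<mu> f"
  shows "f \<in> borel_measurable borel"
proof -
  obtain e :: 'a where e: "norm e = 1"
    using vector_choose_size[of 1] by auto
  have le: "f y \<le> f x" if "x \<noteq> 0" "norm x \<le> norm y" for x y
    using f that by (simp add: isotropic_unimodal_density_def)
  have "mono_on {0<..} (\<lambda>u. - f (u *\<^sub>R e))"
    using e by (intro mono_onI) (auto intro!: le)
  then have "(\<lambda>u. - f (u *\<^sub>R e)) \<in> borel_measurable (restrict_space borel {0<..})"
    by (rule borel_measurable_mono_on_fnc)
  from borel_measurable_uminus[OF this]
  have "(\<lambda>u. f (u *\<^sub>R e)) \<in> borel_measurable (restrict_space borel {0<..})"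
    by simp
  then have [measurable]: "(\<lambda>u. if u \<in> {0<..} then f (u *\<^sub>R e) else 0) \<in> borel_measurable borel"
    by (subst (asm) measurable_restrict_space_iff[where c = 0]) auto
  have "f = (\<lambda>x. if x = 0 then f 0 else (\<lambda>u. if u \<in> {0<..} then f (u *\<^sub>R e) else 0) (norm x))"
  proof
    fix x
    have "f x = f (norm x *\<^sub>R e)" if "x \<noteq> 0"
      using that e by (intro antisym le) auto
    then show "f x = (if x = 0 then f 0 else (\<lambda>u. if u \<in> {0<..} then f (u *\<^sub>R e) else 0) (norm x))"
      by simp
  qed
  also have "\<dots> \<in> borel_measurable borel" by measurable
  finally show ?thesis .
qed

lemma isotropic_unimodal_density_scaleR:
  fixes \<mu> :: "'a::euclidean_space measure"
  assumes f: "isotropic_unimodal_density \<mu> f" and sets[measurable_cong]: "sets \<mu> = sets borel" and r: "0 < r"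
  shows "isotropic_unimodal_density (distr \<mu> borel (\<lambda>y. y /\<^sub>R r)) (\<lambda>y. r ^ DIM('a) * f (r *\<^sub>R y))"
  unfolding isotropic_unimodal_density_def
proof (intro conjI allI impI ballI)
  note [measurable] = isotropic_unimodal_density_measurable[OF f]
  show "0 \<le> r ^ DIM('a) * f (r *\<^sub>R x)" if "x \<noteq> 0" for x
    using f r that by (simp add: isotropic_unimodal_density_def)
  show "r ^ DIM('a) * f (r *\<^sub>R y) \<le> r ^ DIM('a) * f (r *\<^sub>R x)" if "x \<noteq> 0" "norm x \<le> norm y" for x y
    using f r that by (intro mult_left_mono) (auto simp: isotropic_unimodal_density_def)
  fix A :: "'a set" assume A[measurable]: "A \<in> sets borel" and "0 \<notin> A"
  define B where "B = {y. y /\<^sub>R r \<in> A}"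
  have [measurable]: "B \<in> sets borel"
    unfolding B_def by measurable
  have "emeasure (distr \<mu> borel (\<lambda>y. y /\<^sub>R r)) A = emeasure \<mu> B"
    using sets_eq_imp_space_eq[OF sets] by (simp add: emeasure_distr B_def vimage_def)
  also have "\<dots> = (\<integral>\<^sup>+y. ennreal (f y) * indicator B y \<partial>lborel)"
    using f \<open>0 \<notin> A\<close> by (simp add: isotropic_unimodal_density_def B_def)
  also have "\<dots> = (\<integral>\<^sup>+y. ennreal (r ^ DIM('a)) * (ennreal (f (r *\<^sub>R y)) * indicator B (r *\<^sub>R y)) \<partial>lborel)"
    using r by (subst lborel_affine[of r 0]) (simp_all add: nn_integral_density nn_integral_distr)
  also have "\<dots> = (\<integral>\<^sup>+y\<in>A. ennreal (r ^ DIM('a) * f (r *\<^sub>R y)) \<partial>lborel)"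
    using r by (intro nn_integral_cong) (simp add: B_def indicator_def ennreal_mult')
  finally show "emeasure (distr \<mu> borel (\<lambda>y. y /\<^sub>R r)) A = (\<integral>\<^sup>+y\<in>A. ennreal (r ^ DIM('a) * f (r *\<^sub>R y)) \<partial>lborel)" .
qed

text \<open>
  The reflection in the hyperplane orthogonal to \<open>\<xi> - \<zeta>\<close> exchanges the two vectors and is
  self-adjoint.
\<close>

lemma ex_reflection_swap:
  fixes \<xi> \<zeta> :: "'a::euclidean_space"
  assumes "norm \<xi> = norm \<zeta>"
  shows "\<exists>U. orthogonal_transformation U \<and> (\<forall>x. \<xi> \<bullet> U x = \<zeta> \<bullet> x)"
proof (cases "\<xi> = \<zeta>")
  case True
  then show ?thesis
    by (intro exI[of _ "\<lambda>x. x"]) (auto simp: orthogonal_transformation_def)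
next
  case False
  define w where "w = \<xi> - \<zeta>"
  have w: "w \<bullet> w \<noteq> 0" using False by (simp add: w_def)
  define k where "k x = 2 * (x \<bullet> w) / (w \<bullet> w)" for x
  define U where "U x = x - k x *\<^sub>R w" for x
  have k: "k x * (w \<bullet> w) = 2 * (x \<bullet> w)" for x
    using w by (simp add: k_def)
  have "\<xi> \<bullet> \<xi> = \<zeta> \<bullet> \<zeta>"
    using assms by (simp add: power2_norm_eq_inner[symmetric])
  then have ww: "w \<bullet> w = 2 * (\<xi> \<bullet> w)"
    by (simp add: w_def inner_diff_left inner_diff_right inner_commute)
  have "\<xi> \<bullet> U x = \<zeta> \<bullet> x" for x
  proof -
    have "\<xi> \<bullet> U x = \<xi> \<bullet> x - (x \<bullet> w) * (2 * (\<xi> \<bullet> w) / (w \<bullet> w))"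
      by (simp add: U_def k_def inner_diff_right)
    also have "2 * (\<xi> \<bullet> w) / (w \<bullet> w) = 1"
      by (simp only: ww[symmetric] divide_self[OF w])
    finally show ?thesis
      by (simp add: w_def inner_diff_right inner_commute)
  qed
  moreover have "orthogonal_transformation U"
    unfolding orthogonal_transformation_def
  proof (intro conjI allI)
    show "linear U"
    proof (rule linearI)
      show "U (x + y) = U x + U y" for x y
        by (simp add: U_def k_def inner_add_left distrib_left add_divide_distrib scaleR_add_left)
      show "U (c *\<^sub>R x) = c *\<^sub>R U x" for c x
        by (simp add: U_def k_def scaleR_diff_right)
    qed
    show "U x \<bullet> U y = x \<bullet> y" for x y
    proof -
      have "U x \<bullet> U y = x \<bullet> y - k y * (x \<bullet> w) - k x * (y \<bullet> w) + k y * (k x * (w \<bullet> w))"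
        by (simp add: U_def inner_diff_left inner_diff_right inner_commute[of w y] algebra_simps)
      also have "\<dots> = x \<bullet> y + (k y * (x \<bullet> w) - k x * (y \<bullet> w))"
        by (simp add: k)
      also have "k y * (x \<bullet> w) = k x * (y \<bullet> w)"
        by (simp only: k_def times_divide_eq_left mult.assoc mult.commute[of "x \<bullet> w"])
      finally show ?thesis by simp
    qed
  qed
  ultimately show ?thesis by blast
qed

lemma rotation_invariant_integral_cos_cong:
  fixes \<mu> :: "'a::euclidean_space measure"
  assumes "rotation_invariant \<mu>" and [measurable_cong]: "sets \<mu> = sets borel" and "norm \<xi> = norm \<zeta>"
  shows "(LINT x|\<mu>. cos (\<xi> \<bullet> x)) = (LINT x|\<mu>. cos (\<zeta> \<bullet> x))"
proof -
  obtain U where U: "orthogonal_transformation U" "\<And>x. \<xi> \<bullet> U x = \<zeta> \<bullet> x"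
    using ex_reflection_swap[OF assms(3)] by blast
  have [measurable]: "U \<in> borel_measurable borel"
    using U(1) by (intro borel_measurable_continuous_onI linear_continuous_on)
      (simp add: orthogonal_transformation_linear linear_conv_bounded_linear[symmetric])
  have "(LINT x|\<mu>. cos (\<xi> \<bullet> x)) = (LINT x|distr \<mu> borel U. cos (\<xi> \<bullet> x))"
    using assms(1) U(1) by (simp add: rotation_invariant_def)
  also have "\<dots> = (LINT x|\<mu>. cos (\<zeta> \<bullet> x))"
    by (subst integral_distr) (auto simp: U)
  finally show ?thesis .
qed

text \<open>
  Since \<open>\<rho>\<close> may vanish, the quotient is written as \<open>k (-s \<rho>) \<rho>\<close>, where \<open>k z = (exp z - 1) / z\<close> is
  extended continuously to 0.
\<close>

lemma tendsto_one_minus_exp_div: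
  fixes s \<rho> :: "nat \<Rightarrow> real"
  assumes s: "\<And>n. 0 < s n" "s \<longlonglongrightarrow> 0" and \<rho>: "\<rho> \<longlonglongrightarrow> l"
  shows "(\<lambda>n. (1 - exp (- (s n * \<rho> n))) / s n) \<longlonglongrightarrow> l"
proof -
  define k where "k z = (if z = 0 then 1 else (exp z - 1) / z)" for z :: real
  have "((\<lambda>z. (exp z - 1) / z) \<longlongrightarrow> 1) (at (0::real))"
    using DERIV_exp[of "0::real"] by (simp add: DERIV_def)
  then have "(k \<longlongrightarrow> 1) (at 0)"
    by (rule Lim_transform_eventually) (auto simp: k_def eventually_at_filter)
  then have "isCont k 0"
    by (simp add: isCont_def k_def)
  moreover have "(\<lambda>n. - (s n * \<rho> n)) \<longlonglongrightarrow> 0"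
    using tendsto_mult[OF s(2) \<rho>] by (auto intro: tendsto_eq_intros)
  ultimately have "(\<lambda>n. k (- (s n * \<rho> n))) \<longlonglongrightarrow> k 0"
    by (rule isCont_tendsto_compose)
  then have "(\<lambda>n. k (- (s n * \<rho> n)) * \<rho> n) \<longlonglongrightarrow> k 0 * l"
    by (intro tendsto_mult \<rho>)
  moreover have "k (- (s n * \<rho> n)) * \<rho> n = (1 - exp (- (s n * \<rho> n))) / s n" for n
    using s(1)[of n] by (auto simp: k_def field_simps)
  ultimately show ?thesis by (simp add: k_def)
qed

section \<open>Densities of isotropic unimodal Levy processes\<close>

theorem theorem5:
  fixes M :: "'w measure"
    and X :: "real \<Rightarrow> 'w \<Rightarrow> 'a::euclidean_space"
    and \<psi> :: "'a \<Rightarrow> real"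
    and p :: "real \<Rightarrow> 'a \<Rightarrow> real"
    and \<alpha> :: real
  assumes "isotropic_unimodal_levy_process M X"
    and "levy_khintchine_exponent M X \<psi>"
    and "\<And>t. 0 < t \<Longrightarrow> isotropic_unimodal_density (distr M borel (X t)) (p t)"
    and "0 < \<alpha>" and "\<alpha> < 2"
    and "regularly_varying_at_top \<alpha> (radial_profile \<psi>)"
  shows "\<forall>\<epsilon>>0. \<exists>\<delta>>0. \<forall>t>0. \<forall>x. 0 < norm x \<longrightarrow> norm x \<le> \<delta> \<longrightarrow>
           t * radial_profile \<psi> (inverse (norm x)) \<le> \<delta> \<longrightarrow>
           \<bar>p t x / (norm x powr (- real DIM('a)) * t * radial_profile \<psi> (inverse (norm x)))
              - limit_constant DIM('a) \<alpha>\<bar> < \<epsilon>"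
proof (rule ccontr)
  interpret isotropic_unimodal_levy_process M X by fact
  define P where "P t = distr M borel (X t)" for t
  have sets_P[measurable_cong, simp]: "sets (P t) = sets borel" for t by (simp add: P_def)
  have prob_P: "prob_space (P t)" if "0 < t" for t
    unfolding P_def using random_variable[of t] that by (intro prob_space_distr) simp
  have cos_P: "(LINT x|P t. cos (\<xi> \<bullet> x)) = exp (- t * \<psi> \<xi>)" if "0 < t" for t \<xi>
  proof -
    interpret P: prob_space "P t" by (rule prob_P[OF that])
    have "integrable (P t) (\<lambda>x. iexp (\<xi> \<bullet> x))"
      by (rule P.integrable_const_bound[where B = 1]) auto
    from integral_Re[OF this] show ?thesis
      using assms(2) that by (simp add: levy_khintchine_exponent_def P_def Re_exp del: of_real_exp)
  qed
  define R where "R = radial_profile \<psi>"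
  have radial: "\<psi> \<xi> = \<psi> \<zeta>" if "norm \<xi> = norm \<zeta>" for \<xi> \<zeta>
    using rotation_invariant_integral_cos_cong[OF _ sets_P that, of 1] isotropic[of 1] cos_P[of 1]
    by (simp add: P_def)
  have R: "R (norm \<xi>) = \<psi> \<xi>" for \<xi>
  proof -
    have "\<psi> ` sphere 0 (norm \<xi>) \<subseteq> {\<psi> \<xi>}"
    proof (intro image_subsetI, unfold singleton_iff)
      show "\<psi> \<zeta> = \<psi> \<xi>" if "\<zeta> \<in> sphere 0 (norm \<xi>)" for \<zeta>
        using that by (intro radial) simp
    qed
    moreover have "\<psi> \<xi> \<in> \<psi> ` sphere 0 (norm \<xi>)"
      by (intro imageI) simp
    ultimately have "\<psi> ` sphere 0 (norm \<xi>) = {\<psi> \<xi>}"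
      by blast
    then show ?thesis by (simp add: R_def radial_profile_def)
  qed
  have "\<psi> 0 = 0"
    using cos_P[of 1 0] prob_space.prob_space[OF prob_P[of 1]] by simp
  obtain x\<^sub>0 where x\<^sub>0: "0 < x\<^sub>0" "\<And>x. x\<^sub>0 \<le> x \<Longrightarrow> 0 < R x"
    and reg: "\<And>c. 0 < c \<Longrightarrow> ((\<lambda>x. R (c * x) / R x) \<longlongrightarrow> c powr \<alpha>) at_top"
    using assms(6) by (auto simp: regularly_varying_at_top_def R_def)
  assume "\<not> ?thesis"
  then obtain \<epsilon> where "0 < \<epsilon>" and bad: "\<not> (\<exists>\<delta>>0. \<forall>t>0. \<forall>x. 0 < norm x \<longrightarrow> norm x \<le> \<delta> \<longrightarrow>
           t * R (inverse (norm x)) \<le> \<delta> \<longrightarrow>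
           \<bar>p t x / (norm x powr (- real DIM('a)) * t * R (inverse (norm x))) - limit_constant DIM('a) \<alpha>\<bar> < \<epsilon>)"
    unfolding R_def by blast
  \<comment> \<open>the bound by \<open>inverse x\<^sub>0\<close> keeps \<open>1/|x|\<close> where the exponent is positive\<close>
  define \<delta> where "\<delta> n = min (inverse x\<^sub>0) (inverse (real (Suc n)))" for n
  have "0 < \<delta> n" for n using x\<^sub>0(1) by (simp add: \<delta>_def)
  then have "\<forall>n. \<exists>t x. 0 < t \<and> 0 < norm x \<and> norm x \<le> \<delta> n \<and> t * R (inverse (norm x)) \<le> \<delta> n \<and>
      \<epsilon> \<le> \<bar>p t x / (norm x powr (- real DIM('a)) * t * R (inverse (norm x))) - limit_constant DIM('a) \<alpha>\<bar>"
    using bad by (meson not_le)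
  then obtain t x where tx: "\<And>n. 0 < t n" "\<And>n. 0 < norm (x n)" "\<And>n. norm (x n) \<le> \<delta> n"
      "\<And>n. t n * R (inverse (norm (x n))) \<le> \<delta> n"
    and far: "\<And>n. \<epsilon> \<le> \<bar>p (t n) (x n) / (norm (x n) powr (- real DIM('a)) * t n * R (inverse (norm (x n)))) - limit_constant DIM('a) \<alpha>\<bar>"
    by metis
  define r where "r n = norm (x n)" for n
  define s where "s n = t n * R (inverse (r n))" for n
  have r: "0 < r n" "r n \<le> inverse x\<^sub>0" "r n \<le> inverse (real (Suc n))" for n
    using tx(2,3)[of n] by (simp_all add: r_def \<delta>_def)
  have "x\<^sub>0 \<le> inverse (r n)" for n
    using le_imp_inverse_le[OF r(2,1)] by simp
  then have R_pos: "0 < R (inverse (r n))" for n by (rule x\<^sub>0(2))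
  then have s_pos: "0 < s n" for n
    using tx(1) by (simp add: s_def)
  have r_lim: "r \<longlonglongrightarrow> 0"
    by (rule tendsto_sandwich[OF _ _ tendsto_const LIMSEQ_inverse_real_of_nat]) (use r in \<open>auto intro!: always_eventually less_imp_le\<close>)
  have s_lim: "s \<longlonglongrightarrow> 0"
    by (rule tendsto_sandwich[OF _ _ tendsto_const LIMSEQ_inverse_real_of_nat])
      (use s_pos tx(4) in \<open>auto simp: s_def r_def \<delta>_def intro!: always_eventually less_imp_le\<close>)
  have inv_r: "filterlim (\<lambda>n. inverse (r n)) at_top sequentially"
    by (rule filterlim_inverse_at_top[OF r_lim]) (simp add: r)
  define \<mu> where "\<mu> n = distr (P (t n)) borel (\<lambda>y. y /\<^sub>R r n)" for n
  define q where "q n y = r n ^ DIM('a) * p (t n) (r n *\<^sub>R y)" for n y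
  obtain e :: 'a where e: "norm e = 1"
    using vector_choose_size[of 1] by auto
  have q_lim: "(\<lambda>n. q n e / s n) \<longlonglongrightarrow> limit_constant DIM('a) \<alpha>"
  proof (rule tendsto_unimodal_density[OF _ _ _ s_pos assms(4,5) _ e, where \<mu> = \<mu>])
    show "prob_space (\<mu> n)" for n
      unfolding \<mu>_def using prob_P[OF tx(1)] by (rule prob_space.prob_space_distr) simp
    show "sets (\<mu> n) = sets borel" for n by (simp add: \<mu>_def)
    show "isotropic_unimodal_density (\<mu> n) (q n)" for n
      unfolding \<mu>_def q_def[abs_def]
      using assms(3)[OF tx(1)] r(1) by (intro isotropic_unimodal_density_scaleR) (auto simp: P_def)
    fix \<xi> :: 'a
    have cos_\<mu>: "(LINT y|\<mu> n. cos (\<xi> \<bullet> y)) = exp (- t n * \<psi> (\<xi> /\<^sub>R r n))" for n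
      unfolding \<mu>_def using cos_P[OF tx(1), of n "\<xi> /\<^sub>R r n"] by (subst integral_distr) auto
    show "(\<lambda>n. (1 - (LINT y|\<mu> n. cos (\<xi> \<bullet> y))) / s n) \<longlonglongrightarrow> norm \<xi> powr \<alpha>"
    proof (cases "\<xi> = 0")
      case True
      then show ?thesis unfolding cos_\<mu> by (simp add: \<open>\<psi> 0 = 0\<close>)
    next
      case False
      have "(\<lambda>n. R (norm \<xi> * inverse (r n)) / R (inverse (r n))) \<longlonglongrightarrow> norm \<xi> powr \<alpha>"
        using filterlim_compose[OF reg inv_r] False by simp
      from tendsto_one_minus_exp_div[OF s_pos s_lim this]
      have "(\<lambda>n. (1 - exp (- (s n * (R (norm \<xi> * inverse (r n)) / R (inverse (r n)))))) / s n) \<longlonglongrightarrow> norm \<xi> powr \<alpha>" .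
      moreover have "s n * (R (norm \<xi> * inverse (r n)) / R (inverse (r n))) = t n * \<psi> (\<xi> /\<^sub>R r n)" for n
        using R[of "\<xi> /\<^sub>R r n"] R_pos[of n] r(1)[of n] by (simp add: s_def mult.commute)
      ultimately show ?thesis by (simp add: cos_\<mu>)
    qed
  qed
  have q_eq: "q n e / s n = p (t n) (x n) / (norm (x n) powr (- real DIM('a)) * t n * R (inverse (norm (x n))))" for n
  proof -
    have norm_eq: "norm (r n *\<^sub>R e) = norm (x n)"
      using e by (simp add: r_def)
    have ne: "x n \<noteq> 0" "r n *\<^sub>R e \<noteq> 0"
      using e tx(2)[of n] r(1)[of n] by force+
    have mono: "p (t n) z \<le> p (t n) y" if "y \<noteq> 0" "norm y \<le> norm z" for y z
      using assms(3)[OF tx(1), of n] that unfolding isotropic_unimodal_density_def by blast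
    have p_eq: "p (t n) (r n *\<^sub>R e) = p (t n) (x n)"
      by (rule antisym; rule mono) (use norm_eq ne in auto)
    have norm_powr: "norm (x n) powr (- real DIM('a)) = 1 / r n ^ DIM('a)"
      using r(1)[of n] by (simp add: r_def powr_minus_divide powr_realpow)
    show ?thesis
      unfolding norm_powr q_def p_eq unfolding s_def r_def by simp
  qed
  have "(\<lambda>n. p (t n) (x n) / (norm (x n) powr (- real DIM('a)) * t n * R (inverse (norm (x n))))) \<longlonglongrightarrow> limit_constant DIM('a) \<alpha>"
    using q_lim unfolding q_eq .
  then have "\<forall>\<^sub>F n in sequentially. \<bar>p (t n) (x n) / (norm (x n) powr (- real DIM('a)) * t n * R (inverse (norm (x n)))) - limit_constant DIM('a) \<alpha>\<bar> < \<epsilon>"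
    using \<open>0 < \<epsilon>\<close> unfolding tendsto_iff dist_real_def by blast
  then obtain n where "\<bar>p (t n) (x n) / (norm (x n) powr (- real DIM('a)) * t n * R (inverse (norm (x n)))) - limit_constant DIM('a) \<alpha>\<bar> < \<epsilon>"
    using eventually_happens[of _ sequentially] by auto
  with far[of n] show False by simp
qed

end
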